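(* Let $k_1,\dots,k_5>0$ and consider the 3D nonholonomic vehicle $$\dot x=v\cos\psi\cos\theta,\quad \dot y=v\sin\psi\cos\theta,\quad \dot z=v\sin\theta,\quad \dot\psi=\frac{r}{\cos\theta},\quad \dot\theta=q,$$ in closed loop with the feedback law $v$, $q$, $r=\tilde r\cos\theta$ given in the context (so that $\dot\psi=\tilde r$). Then there exist constants $K\ge1$ and $\lambda>0$, being constants for which the spherical-coordinate estimate $|\Theta(t)|_{\mathcal D}\le K|\Theta(t_0)|_{\mathcal D}e^{-\lambda(t-t_0)}$, $t\ge t_0$, holds for all closed-loop solutions starting in $\mathcal D$, such that for all initial conditions $(x_0,y_0,z_0,\psi_0,\theta_0)\in\mathbb R^5$ at time $t_0$ with $x_0^2+y_0^2>0$, and all $t\ge t_0$, $$|x(t)|+|y(t)|+|z(t)|+|\psi(t)|+|\theta(t)|\le\beta\Bigl(|x_0|+|y_0|+|z_0|+|\psi_0|+|\theta_0|+|\mathrm{atan2}(-y_0,-x_0)|+\frac{|z_0|}{\sqrt{x_0^2+y_0^2}},\;t\Bigr),$$ where $\beta\in\mathcal{KL}$ is defined by $\beta(s,t)=2\sqrt3\,K\,s\,e^{-\lambda(t-t_0)}$.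
   Context: Spherical coordinates (for $x^2+y^2>0$): $\rho=\sqrt{x^2+y^2+z^2}$, $\delta=\mathrm{atan2}(-y,-x)$, $\gamma=\mathrm{atan2}(-y,-x)-\psi=\delta-\psi$, $\zeta=\arcsin(z/\rho)$, $\theta=\theta$; $\Theta=(\rho,\delta,\gamma,\zeta,\theta)^\top$. The state space is $\mathcal D=\{\rho>0\}\times\{(\delta,\gamma,\zeta,\theta)\in\mathbb R^4:|\zeta|<\pi/2\}$ with $|\Theta|_{\mathcal D}=\rho+|\delta|+|\gamma|+|\tan\zeta|+|\theta|$. Along solutions, $\delta$ and $\gamma$ are real-valued (not wrapped): $\delta(t)$ is the continuous angle with $\delta(t_0)=\mathrm{atan2}(-y_0,-x_0)$ and $\gamma(t)=\delta(t)-\psi(t)$, so that $$\begin{aligned} \dot\rho&=v(\sin\theta\sin\zeta-\cos\theta\cos\zeta\cos\gamma),\quad \dot\delta=\frac{v\cos\theta}{\rho\cos\zeta}\sin\gamma,\quad \dot\gamma=\frac{v\cos\theta}{\rho\cos\zeta}\sin\gamma-\tilde r,\\ \dot\zeta&=\frac v\rho(\cos\theta\sin\zeta\cos\gamma+\sin\theta\cos\zeta),\quad \dot\theta=q. \end{aligned}$$ Auxiliary quantities: $$\eta=\frac{k_3\sin\zeta+\tan\zeta}{\sqrt{1+k_2^2\delta^2\cos^2\zeta}},\quad e_1=\gamma+\arctan(k_2\delta\cos\zeta),\quad e_2=\theta+\arctan\eta,$$ $$N=\sqrt{1+k_2^2\delta^2\cos^2\zeta},\quad B=\sqrt{1+\eta^2},\quad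 C=1+k_3\cos\zeta+\tan^2\zeta+k_2^2\delta^2(2+k_3\cos\zeta-\cos^2\zeta),$$ $$\sigma_1(a,b)=\frac{\sin(a-b)+\sin b}{a},\quad\sigma_2(a,b)=\frac{\cos b-\cos(a-b)}{a},\quad \sigma_1(0,b)=\cos b,\ \sigma_2(0,b)=-\sin b.$$ Feedback law: $$v=k_1\rho NB,$$ $$\begin{aligned} q=&-k_5e_2+k_1k_2\delta^2\sigma_2(e_2,\theta)B\\ &+\frac{k_1}{N^2B}\Bigl[k_2^2\delta\cos\theta\cos\zeta\sin\gamma\,(k_3\sin\zeta+\tan\zeta)-(\cos\theta\sin\zeta\cos\gamma+\sin\theta\cos\zeta)\,C\Bigr]\\ &-k_1\rho^2B\bigl(\sin\zeta\,\sigma_1(e_2,\theta)N-\cos\zeta\,\sigma_2(e_2,\theta)\bigr)\\ &-\frac{k_1\tan\zeta\,B}{\cos^2\zeta}\bigl(\sin\zeta\,\sigma_2(e_2,\theta)+\cos\zeta\,\sigma_1(e_2,\theta)N\bigr), \end{aligned}$$ and $r=\tilde r\cos\theta$ with $$\begin{aligned} \tilde r=&\;k_4e_1+\frac{k_1NB}{\cos\zeta}\cos\theta\sin\gamma\\ &+\frac{k_1k_2B}{N}\Bigl[\cos\theta\sin\gamma-\delta\Bigl(\cos\theta\sin^2\zeta\cos\gamma+\frac{\sin\theta\sin(2\zeta)}{2}\Bigr)\Bigr]\\ &-k_1\rho^2\cos\zeta\,N\bigl(\sigma_2(e_1,\gamma)+e_2\sigma_2(e_1,\gamma)\sigma_2(e_2,\theta)B\bigr)\\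 &+\frac{k_1\delta\,\sigma_1(e_1,\gamma)N}{\cos\zeta}\bigl(1+e_2\sigma_2(e_2,\theta)B\bigr)\\ &+\frac{k_1\tan\zeta\,N}{\cos^2\zeta}\sin\zeta\,\bigl(\sigma_2(e_1,\gamma)+e_2\sigma_2(e_1,\gamma)\sigma_2(e_2,\theta)B\bigr). \end{aligned}$$ *)

theory Defs
  imports "HOL-Analysis.Analysis"
begin

definition atan2 :: "real \<Rightarrow> real \<Rightarrow> real" where
  "atan2 y x = Arg (Complex x y)"

(* Both states live in real^5: spherical states are ordered (rho, delta, gamma, zeta, theta),
   Cartesian ones (x, y, z, psi, theta). *)

type_synonym state = "real \<times> real \<times> real \<times> real \<times> real"

definition state_space :: "state set" where
  "state_space = {(\<rho>, \<delta>, \<gamma>, \<zeta>, \<theta>). \<rho> > 0 \<and> \<bar>\<zeta>\<bar> < pi / 2}"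

definition norm_D :: "state \<Rightarrow> real" where
  "norm_D = (\<lambda>(\<rho>, \<delta>, \<gamma>, \<zeta>, \<theta>). \<rho> + \<bar>\<delta>\<bar> + \<bar>\<gamma>\<bar> + \<bar>tan \<zeta>\<bar> + \<bar>\<theta>\<bar>)"

definition sigma1 :: "real \<Rightarrow> real \<Rightarrow> real" where
  "sigma1 a b = (if a = 0 then cos b else (sin (a - b) + sin b) / a)"

definition sigma2 :: "real \<Rightarrow> real \<Rightarrow> real" where
  "sigma2 a b = (if a = 0 then - sin b else (cos b - cos (a - b)) / a)"

definition aux_N :: "real \<Rightarrow> state \<Rightarrow> real" where
  "aux_N k2 = (\<lambda>(\<rho>, \<delta>, \<gamma>, \<zeta>, \<theta>). sqrt (1 + k2\<^sup>2 * \<delta>\<^sup>2 * (cos \<zeta>)\<^sup>2))"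

definition aux_eta :: "real \<Rightarrow> real \<Rightarrow> state \<Rightarrow> real" where
  "aux_eta k2 k3 = (\<lambda>(\<rho>, \<delta>, \<gamma>, \<zeta>, \<theta>).
     (k3 * sin \<zeta> + tan \<zeta>) / sqrt (1 + k2\<^sup>2 * \<delta>\<^sup>2 * (cos \<zeta>)\<^sup>2))"

definition aux_e1 :: "real \<Rightarrow> state \<Rightarrow> real" where
  "aux_e1 k2 = (\<lambda>(\<rho>, \<delta>, \<gamma>, \<zeta>, \<theta>). \<gamma> + arctan (k2 * \<delta> * cos \<zeta>))"

definition aux_e2 :: "real \<Rightarrow> real \<Rightarrow> state \<Rightarrow> real" where
  "aux_e2 k2 k3 = (\<lambda>(\<rho>, \<delta>, \<gamma>, \<zeta>, \<theta>). \<theta> + arctan (aux_eta k2 k3 (\<rho>, \<delta>, \<gamma>, \<zeta>, \<theta>)))"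

definition aux_B :: "real \<Rightarrow> real \<Rightarrow> state \<Rightarrow> real" where
  "aux_B k2 k3 s = sqrt (1 + (aux_eta k2 k3 s)\<^sup>2)"

definition aux_C :: "real \<Rightarrow> real \<Rightarrow> state \<Rightarrow> real" where
  "aux_C k2 k3 = (\<lambda>(\<rho>, \<delta>, \<gamma>, \<zeta>, \<theta>).
     1 + k3 * cos \<zeta> + (tan \<zeta>)\<^sup>2 + k2\<^sup>2 * \<delta>\<^sup>2 * (2 + k3 * cos \<zeta> - (cos \<zeta>)\<^sup>2))"

definition feedback_v :: "real \<Rightarrow> real \<Rightarrow> real \<Rightarrow> state \<Rightarrow> real" where
  "feedback_v k1 k2 k3 = (\<lambda>(\<rho>, \<delta>, \<gamma>, \<zeta>, \<theta>).
     k1 * \<rho> * aux_N k2 (\<rho>, \<delta>, \<gamma>, \<zeta>, \<theta>) * aux_B k2 k3 (\<rho>, \<delta>, \<gamma>, \<zeta>, \<theta>))"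

definition feedback_q :: "real \<Rightarrow> real \<Rightarrow> real \<Rightarrow> real \<Rightarrow> state \<Rightarrow> real" where
  "feedback_q k1 k2 k3 k5 = (\<lambda>(\<rho>, \<delta>, \<gamma>, \<zeta>, \<theta>).
     let N = aux_N k2 (\<rho>, \<delta>, \<gamma>, \<zeta>, \<theta>);
         B = aux_B k2 k3 (\<rho>, \<delta>, \<gamma>, \<zeta>, \<theta>);
         C = aux_C k2 k3 (\<rho>, \<delta>, \<gamma>, \<zeta>, \<theta>);
         e2 = aux_e2 k2 k3 (\<rho>, \<delta>, \<gamma>, \<zeta>, \<theta>)
     in - k5 * e2 + k1 * k2 * \<delta>\<^sup>2 * sigma2 e2 \<theta> * B
        + k1 / (N\<^sup>2 * B) *
            (k2\<^sup>2 * \<delta> * cos \<theta> * cos \<zeta> * sin \<gamma> * (k3 * sin \<zeta> + tan \<zeta>)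
             - (cos \<theta> * sin \<zeta> * cos \<gamma> + sin \<theta> * cos \<zeta>) * C)
        - k1 * \<rho>\<^sup>2 * B * (sin \<zeta> * sigma1 e2 \<theta> * N - cos \<zeta> * sigma2 e2 \<theta>)
        - k1 * tan \<zeta> * B / (cos \<zeta>)\<^sup>2 *
            (sin \<zeta> * sigma2 e2 \<theta> + cos \<zeta> * sigma1 e2 \<theta> * N))"

definition feedback_r_tilde :: "real \<Rightarrow> real \<Rightarrow> real \<Rightarrow> real \<Rightarrow> state \<Rightarrow> real" where
  "feedback_r_tilde k1 k2 k3 k4 = (\<lambda>(\<rho>, \<delta>, \<gamma>, \<zeta>, \<theta>).
     let N = aux_N k2 (\<rho>, \<delta>, \<gamma>, \<zeta>, \<theta>);
         B = aux_B k2 k3 (\<rho>, \<delta>, \<gamma>, \<zeta>, \<theta>);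
         e1 = aux_e1 k2 (\<rho>, \<delta>, \<gamma>, \<zeta>, \<theta>);
         e2 = aux_e2 k2 k3 (\<rho>, \<delta>, \<gamma>, \<zeta>, \<theta>)
     in k4 * e1 + k1 * N * B / cos \<zeta> * cos \<theta> * sin \<gamma>
        + k1 * k2 * B / N *
            (cos \<theta> * sin \<gamma>
             - \<delta> * (cos \<theta> * (sin \<zeta>)\<^sup>2 * cos \<gamma> + sin \<theta> * sin (2 * \<zeta>) / 2))
        - k1 * \<rho>\<^sup>2 * cos \<zeta> * N *
            (sigma2 e1 \<gamma> + e2 * sigma2 e1 \<gamma> * sigma2 e2 \<theta> * B)
        + k1 * \<delta> * sigma1 e1 \<gamma> * N / cos \<zeta> * (1 + e2 * sigma2 e2 \<theta> * B)
        + k1 * tan \<zeta> * N / (cos \<zeta>)\<^sup>2 * sin \<zeta> *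
            (sigma2 e1 \<gamma> + e2 * sigma2 e1 \<gamma> * sigma2 e2 \<theta> * B))"

definition spherical_field ::
    "real \<Rightarrow> real \<Rightarrow> real \<Rightarrow> real \<Rightarrow> real \<Rightarrow> state \<Rightarrow> state" where
  "spherical_field k1 k2 k3 k4 k5 = (\<lambda>(\<rho>, \<delta>, \<gamma>, \<zeta>, \<theta>).
     let v = feedback_v k1 k2 k3 (\<rho>, \<delta>, \<gamma>, \<zeta>, \<theta>);
         q = feedback_q k1 k2 k3 k5 (\<rho>, \<delta>, \<gamma>, \<zeta>, \<theta>);
         rt = feedback_r_tilde k1 k2 k3 k4 (\<rho>, \<delta>, \<gamma>, \<zeta>, \<theta>)
     in (v * (sin \<theta> * sin \<zeta> - cos \<theta> * cos \<zeta> * cos \<gamma>),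
         v * cos \<theta> / (\<rho> * cos \<zeta>) * sin \<gamma>,
         v * cos \<theta> / (\<rho> * cos \<zeta>) * sin \<gamma> - rt,
         v / \<rho> * (cos \<theta> * sin \<zeta> * cos \<gamma> + sin \<theta> * cos \<zeta>),
         q))"

(* The third input w stands for r / cos theta. The feedback r = rt * cos theta gives w = rt,
   also where cos theta = 0; there the literal quotient would be 0 / 0 = 0 in HOL. *)

definition vehicle_field :: "real \<Rightarrow> real \<Rightarrow> real \<Rightarrow> state \<Rightarrow> state" where
  "vehicle_field v q w = (\<lambda>(x, y, z, \<psi>, \<theta>).
     (v * cos \<psi> * cos \<theta>, v * sin \<psi> * cos \<theta>, v * sin \<theta>, w, q))"

definition to_spherical :: "real \<Rightarrow> state \<Rightarrow> state" where
  "to_spherical \<delta> = (\<lambda>(x, y, z, \<psi>, \<theta>).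
     let \<rho> = sqrt (x\<^sup>2 + y\<^sup>2 + z\<^sup>2) in (\<rho>, \<delta>, \<delta> - \<psi>, arcsin (z / \<rho>), \<theta>))"

definition forward_interval :: "real \<Rightarrow> real set \<Rightarrow> bool" where
  "forward_interval t0 J \<longleftrightarrow> is_interval J \<and> t0 \<in> J \<and> J \<subseteq> {t0..}"

definition spherical_solution ::
    "real \<Rightarrow> real \<Rightarrow> real \<Rightarrow> real \<Rightarrow> real \<Rightarrow> real set \<Rightarrow> (real \<Rightarrow> state) \<Rightarrow> bool" where
  "spherical_solution k1 k2 k3 k4 k5 J \<Theta> \<longleftrightarrow>
     (\<forall>t\<in>J. \<Theta> t \<in> state_space \<and>
        (\<Theta> has_vector_derivative spherical_field k1 k2 k3 k4 k5 (\<Theta> t)) (at t within J))"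

(* The angle of (-x, -y) is not wrapped along a solution: d is the continuous lift
   that starts at the principal value. *)

definition continuous_angle :: "real \<Rightarrow> real set \<Rightarrow> (real \<Rightarrow> state) \<Rightarrow> (real \<Rightarrow> real) \<Rightarrow> bool" where
  "continuous_angle t0 J X d \<longleftrightarrow>
     continuous_on J d \<and>
     (case X t0 of (x, y, z, \<psi>, \<theta>) \<Rightarrow> d t0 = atan2 (- y) (- x)) \<and>
     (\<forall>t\<in>J. case X t of (x, y, z, \<psi>, \<theta>) \<Rightarrow>
        - x = sqrt (x\<^sup>2 + y\<^sup>2) * cos (d t) \<and> - y = sqrt (x\<^sup>2 + y\<^sup>2) * sin (d t))"

definition cartesian_solution ::
    "real \<Rightarrow> real \<Rightarrow> real \<Rightarrow> real \<Rightarrow> real \<Rightarrow> real \<Rightarrow> real set \<Rightarrow> (real \<Rightarrow> state) \<Rightarrow> bool" where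
  "cartesian_solution k1 k2 k3 k4 k5 t0 J X \<longleftrightarrow>
     (\<exists>d. continuous_angle t0 J X d \<and>
        (\<forall>t\<in>J. (case X t of (x, y, z, \<psi>, \<theta>) \<Rightarrow> x\<^sup>2 + y\<^sup>2 > 0) \<and>
           (let \<Theta> = to_spherical (d t) (X t) in
             (X has_vector_derivative
                vehicle_field (feedback_v k1 k2 k3 \<Theta>) (feedback_q k1 k2 k3 k5 \<Theta>)
                  (feedback_r_tilde k1 k2 k3 k4 \<Theta>) (X t)) (at t within J))))"

(* Class KL with time running over [t0, \<infinity>) instead of [0, \<infinity>). *)

definition class_KL :: "real \<Rightarrow> (real \<Rightarrow> real \<Rightarrow> real) \<Rightarrow> bool" where
  "class_KL t0 \<beta> \<longleftrightarrow>
     continuous_on ({0..} \<times> {t0..}) (\<lambda>(s, t). \<beta> s t) \<and>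
     (\<forall>t\<ge>t0. \<beta> 0 t = 0 \<and> strict_mono_on {0..} (\<lambda>s. \<beta> s t)) \<and>
     (\<forall>s\<ge>0. antimono_on {t0..} (\<beta> s) \<and> (\<beta> s \<longlongrightarrow> 0) at_top)"

end

theory Submission
  imports Defs
begin

text \<open>
  The function \<open>V = \<rho>\<^sup>2 + \<delta>\<^sup>2 + tan\<^sup>2 \<zeta> + e\<^sub>1\<^sup>2 + e\<^sub>2\<^sup>2\<close> is a strict Lyapunov function. The identities
  \<open>cos b = cos (a - b) + a \<sigma>\<^sub>2(a, b)\<close> and \<open>sin b = - sin (a - b) + a \<sigma>\<^sub>1(a, b)\<close> split each of the
  \<open>\<rho>\<close>, \<open>\<delta>\<close>, \<open>\<zeta>\<close> equations into its value on \<open>e\<^sub>1 = e\<^sub>2 = 0\<close>, which is dissipative, and terms carrying a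
  factor \<open>e\<^sub>1\<close> or \<open>e\<^sub>2\<close>; the feedback cancels exactly these terms in the derivative of \<open>V\<close>, so that
  \<open>V' \<le> - 2 \<lambda> V\<close> with \<open>\<lambda> = min {k\<^sub>1, k\<^sub>1 k\<^sub>2, k\<^sub>1 k\<^sub>3, k\<^sub>4, k\<^sub>5}\<close>. Since \<open>\<bar>arctan u\<bar> \<le> \<bar>u\<bar>\<close>, the norm on the
  state space is globally equivalent to \<open>sqrt V\<close>, which gives the exponential estimate. The Cartesian
  estimate follows because \<open>\<bar>x\<bar> + \<bar>y\<bar> + \<bar>z\<bar> \<le> sqrt 3 \<rho>\<close> and \<open>\<psi> = \<delta> - \<gamma>\<close>.
\<close>

subsection \<open>Globally Lipschitz initial value problems\<close>

text \<open>The design is backstepping: \<open>\<gamma> = - arctan (k2 \<delta> cos \<zeta>)\<close>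
  and \<open>\<theta> = - arctan \<eta>\<close> are the virtual controls under which
  \<open>\<rho>\<close>, \<open>\<delta>\<close> and \<open>tan \<zeta>\<close> decay, and
  \<open>e1\<close>, \<open>e2\<close> measure the deviation from them. Decay alone says nothing
  about the existence of solutions on the whole half line. The obstacle is that the field is
  Lipschitz only locally and lives on an open set with two boundaries. Taking
  \<open>tan \<zeta>\<close> as coordinate removes the boundary
  \<open>\<bar>\<zeta>\<bar> = pi / 2\<close>. As \<open>v\<close> carries a factor
  \<open>\<rho>\<close>, no division by \<open>\<rho>\<close> survives and \<open>\<rho>\<close>
  obeys a linear equation, hence never reaches 0. What is left is a field on all of the space, whose
  growth is tamed with the help of \<open>V\<close> itself. Passing between the two kinds of
  solutions has its own difficulty: along a Cartesian solution \<open>\<delta>\<close> is only known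
  to be a continuous angle, and its differentiability has to be derived.\<close>

lemma antimono_from_derivative_within:
  fixes f :: "real \<Rightarrow> real"
  assumes "a \<le> b"
    and deriv: "\<And>t. t \<in> {a..b} \<Longrightarrow> (f has_real_derivative f' t) (at t within {a..b})"
    and nonpos: "\<And>t. t \<in> {a..b} \<Longrightarrow> f' t \<le> 0"
  shows "f b \<le> f a"
proof (rule DERIV_nonpos_imp_decreasing_open[OF \<open>a \<le> b\<close>])
  fix t assume "a < t" "t < b"
  then show "\<exists>y. (f has_real_derivative y) (at t) \<and> y \<le> 0"
    using deriv[of t] nonpos[of t] at_within_Icc_at[of a t b] by auto
next
  show "continuous_on {a..b} f"
    using deriv by (meson DERIV_continuous continuous_on_eq_continuous_within)
qed

text \<open>With the weight \<open>exp (- a * t)\<close>, \<open>a \<ge> 2 * L\<close>, the Picard operator is a contraction on the whole half line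
  at once; the bound on the field keeps the weighted iterates bounded.\<close>

lemma global_lipschitz_ivp_0:
  fixes F :: "'a::banach \<Rightarrow> 'a"
  assumes lip: "L-lipschitz_on UNIV F" and bnd: "\<And>x. norm (F x) \<le> M"
  obtains x where "x 0 = x0"
    and "\<And>t. t \<ge> 0 \<Longrightarrow> (x has_vector_derivative F (x t)) (at t within {0..})"
proof -
  \<comment> \<open>The factor 2 yields the contraction constant 1/2; \<open>max L 1\<close> keeps
    the exponent positive even for \<open>L = 0\<close>.\<close>
  define a where "a = 2 * max L 1"
  have a: "a > 0" "L / a \<le> 1/2"
    using lipschitz_on_nonneg[OF lip] by (auto simp: a_def field_simps)
  have M: "M \<ge> 0" using bnd[of undefined] norm_ge_zero order_trans by blast
  have contF: "continuous_on UNIV F" using lip by (rule lipschitz_on_continuous_on)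
  \<comment> \<open>The unknown \<open>y\<close> is the trajectory damped by
    \<open>exp (- a * s)\<close>, so the weight is undone before \<open>F\<close> is
    applied.\<close>
  define g where "g = (\<lambda>(y::real \<Rightarrow>\<^sub>C 'a) s. F (exp (a * s) *\<^sub>R apply_bcontfun y s))"
  have contg: "continuous_on T (g y)" for T y
    unfolding g_def
    by (intro continuous_on_compose2[OF contF] continuous_intros) auto
  have intg: "g y integrable_on {s..t}" for y s t
    by (intro integrable_continuous_real contg)
  define I where "I = (\<lambda>y t. x0 + integral {0..t} (g y))"
  have derI: "(I y has_vector_derivative g y t) (at t within {0..b})" if "t \<in> {0..b}" for y t b
    unfolding I_def
    using integral_has_vector_derivative[OF contg that] by (auto intro!: derivative_eq_intros)
  have contI: "continuous_on {0..} (I y)" for y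
  proof -
    have "continuous (at t within {0..}) (I y)" if "t \<in> {0..}" for t
    proof -
      have "at t within {0..} = at t within {0..t+1}"
        by (rule at_within_nhd[of _ "{..<t+1}"]) (use that in auto)
      then show ?thesis
        using derI[of t "t+1" y] that has_vector_derivative_continuous by fastforce
    qed
    then show ?thesis by (simp add: continuous_on_eq_continuous_within)
  qed
  \<comment> \<open>The clamp \<open>max t 0\<close> extends the image constantly to negative times,
    since the bounded continuous functions live on the whole line.\<close>
  define G where "G = (\<lambda>y t. exp (- a * max t 0) *\<^sub>R I y (max t 0))"
  have contG: "continuous_on UNIV (G y)" for y
    unfolding G_def
    by (intro continuous_intros continuous_on_compose2[OF contI]) auto
  have "norm (G y t) \<le> norm x0 + M / a" for y t
  proof -
    define s where "s = max t 0"
    have s: "s \<ge> 0" by (simp add: s_def)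
    have "norm (integral {0..s} (g y)) \<le> M * (s - 0)"
      by (rule integral_bound) (use s contg bnd in \<open>auto simp: g_def\<close>)
    then have "norm (I y s) \<le> norm x0 + M * s"
      unfolding I_def by (smt (verit) norm_triangle_ineq)
    then have "norm (G y t) \<le> exp (- a * s) * (norm x0 + M * s)"
      by (simp add: G_def flip: s_def)
    also have "\<dots> = exp (- a * s) * norm x0 + M / a * (a * s * exp (- a * s))"
      using a by (simp add: field_simps)
    also have "\<dots> \<le> 1 * norm x0 + M / a * 1"
    proof (intro add_mono mult_right_mono mult_left_mono)
      \<comment> \<open>The integral grows at most linearly; the weight turns this growth into a
        bound uniform in time.\<close>
      have "a * s \<le> exp (a * s)" using exp_ge_add_one_self[of "a * s"] by linarith
      then show "a * s * exp (- a * s) \<le> 1" by (simp add: exp_minus field_simps)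
    qed (use a s M in auto)
    finally show ?thesis by simp
  qed
  then have Gb: "G y \<in> bcontfun" for y
    by (intro bcontfun_normI contG)
  define T where "T = (\<lambda>y. Bcontfun (G y))"
  have T: "apply_bcontfun (T y) = G y" for y
    using Gb by (simp add: T_def Bcontfun_inverse)
  have "dist (T y) (T z) \<le> 1/2 * dist y z" for y z
  proof (rule dist_bound)
    fix t :: real
    define s where "s = max t 0"
    define D where "D = dist y z"
    have s: "s \<ge> 0" by (simp add: s_def)
    have le: "norm (g y r - g z r) \<le> L * D * exp (a * r)" for r
    proof -
      have "norm (g y r - g z r) \<le> L * norm (exp (a * r) *\<^sub>R (y r - z r))"
        using lipschitz_on_normD[OF lip, of "exp (a * r) *\<^sub>R y r" "exp (a * r) *\<^sub>R z r"]
        by (simp add: g_def scaleR_diff_right)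
      also have "\<dots> = L * dist (y r) (z r) * exp (a * r)" by (simp add: dist_norm)
      also have "\<dots> \<le> L * D * exp (a * r)"
        unfolding D_def
        by (intro mult_right_mono mult_left_mono dist_bounded lipschitz_on_nonneg[OF lip]) auto
      finally show ?thesis .
    qed
    have "((\<lambda>r. L * D * exp (a * r)) has_integral (L * D / a * exp (a * s) - L * D / a * exp (a * 0))) {0..s}"
      using a s
      by (intro fundamental_theorem_of_calculus)
         (auto intro!: derivative_eq_intros simp flip: has_real_derivative_iff_has_vector_derivative)
    then have hi: "((\<lambda>r. L * D * exp (a * r)) has_integral (L * D / a * exp (a * s) - L * D / a)) {0..s}"
      by simp
    have "norm (I y s - I z s) = norm (integral {0..s} (\<lambda>r. g y r - g z r))"
      by (simp add: I_def intg integral_diff)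
    also have "\<dots> \<le> integral {0..s} (\<lambda>r. L * D * exp (a * r))"
      by (intro integral_norm_bound_integral le integrable_diff intg) (use hi in auto)
    also have "\<dots> = L * D / a * exp (a * s) - L * D / a"
      by (rule integral_unique[OF hi])
    also have "\<dots> \<le> L / a * D * exp (a * s)"
      using a lipschitz_on_nonneg[OF lip] by (simp add: D_def)
    also have "\<dots> \<le> 1/2 * D * exp (a * s)"
      using a by (intro mult_right_mono) (auto simp: D_def)
    finally have *: "norm (I y s - I z s) \<le> 1/2 * D * exp (a * s)" .
    have "dist (T y t) (T z t) = exp (- a * s) * norm (I y s - I z s)"
      by (simp add: T G_def dist_norm flip: s_def scaleR_diff_right)
    also have "\<dots> \<le> exp (- a * s) * (1/2 * D * exp (a * s))"
      using * by (intro mult_left_mono) auto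
    also have "\<dots> = 1/2 * D" by (simp add: exp_minus)
    finally show "dist (T y t) (T z t) \<le> 1/2 * dist y z" by (simp add: D_def)
  qed
  then obtain y where y: "T y = y"
    using banach_fix_type[of "1/2" T] by auto
  define x where "x = I y"
  have yx: "exp (a * t) *\<^sub>R y t = x t" if "t \<ge> 0" for t
  proof -
    have "y t = G y t" using T y by metis
    then show ?thesis using that by (simp add: G_def x_def exp_minus)
  qed
  show ?thesis
  proof
    show "x 0 = x0" by (simp add: x_def I_def)
    fix t :: real assume t: "t \<ge> 0"
    have "at t within {0..} = at t within {0..t+1}"
      by (rule at_within_nhd[of _ "{..<t+1}"]) (use t in auto)
    moreover have "g y t = F (x t)" using yx[OF t] by (simp add: g_def)
    ultimately show "(x has_vector_derivative F (x t)) (at t within {0..})"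
      using derI[of t "t+1" y] t by (simp add: x_def)
  qed
qed

lemma global_lipschitz_ivp:
  fixes F :: "'a::banach \<Rightarrow> 'a"
  assumes "L-lipschitz_on UNIV F" and "\<And>x. norm (F x) \<le> M"
  shows "\<exists>x. x t0 = x0 \<and> (\<forall>t\<ge>t0. (x has_vector_derivative F (x t)) (at t within {t0..}))"
proof -
  obtain y where y: "y 0 = x0"
    "\<And>t. t \<ge> 0 \<Longrightarrow> (y has_vector_derivative F (y t)) (at t within {0..})"
    using global_lipschitz_ivp_0[OF assms] by metis
  show ?thesis
  proof (intro exI[of _ "\<lambda>t. y (t - t0)"] conjI allI impI)
    show "y (t0 - t0) = x0" by (simp add: y)
    fix t assume t: "t \<ge> t0"
    have "((y \<circ> (\<lambda>t. t - t0)) has_vector_derivative 1 *\<^sub>R F (y (t - t0))) (at t within {t0..})"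
    proof (rule vector_diff_chain_within)
      show "((\<lambda>t. t - t0) has_vector_derivative 1) (at t within {t0..})"
        by (auto intro!: derivative_eq_intros)
      have "(\<lambda>t. t - t0) ` {t0..} \<subseteq> {0..}" by auto
      then show "(y has_vector_derivative F (y (t - t0))) (at (t - t0) within (\<lambda>t. t - t0) ` {t0..})"
        using y(2)[of "t - t0"] t has_vector_derivative_within_subset by fastforce
    qed
    then show "((\<lambda>t. y (t - t0)) has_vector_derivative F (y (t - t0))) (at t within {t0..})"
      by (simp add: o_def)
  qed
qed

text \<open>Because \<open>h + H \<ge> 0\<close>, the quantity \<open>x\<^sup>2 exp (2 H t)\<close>
  is nondecreasing, so it stays positive and \<open>x\<close> cannot have a zero; by continuity it
  cannot change sign either. This serves to keep \<open>\<rho>\<close> positive.\<close>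

lemma positive_of_linear_ode:
  fixes x h :: "real \<Rightarrow> real"
  assumes deriv: "\<And>t. t \<ge> t0 \<Longrightarrow> (x has_real_derivative x t * h t) (at t within {t0..})"
    and h: "\<And>t. \<bar>h t\<bar> \<le> H" and "x t0 > 0" "t \<ge> t0"
  shows "x t > 0"
proof (rule ccontr)
  assume "\<not> x t > 0"
  have sub: "(x has_real_derivative x s * h s) (at s within {t0..t})" if "s \<in> {t0..t}" for s
    using deriv[of s] that DERIV_subset by fastforce
  then have "continuous_on {t0..t} x"
    by (meson DERIV_continuous continuous_on_eq_continuous_within)
  then obtain s where s: "t0 \<le> s" "s \<le> t" "x s = 0"
    using IVT2'[of x t 0 t0] \<open>\<not> x t > 0\<close> assms by fastforce
  have "- ((x s)\<^sup>2 * exp (2 * H * s)) \<le> - ((x t0)\<^sup>2 * exp (2 * H * t0))"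
  proof (rule antimono_from_derivative_within[OF s(1), of "\<lambda>r. - ((x r)\<^sup>2 * exp (2 * H * r))"])
    fix r assume r: "r \<in> {t0..s}"
    have "(x has_real_derivative x r * h r) (at r within {t0..s})"
      using deriv[of r] r DERIV_subset by fastforce
    then show "((\<lambda>r. - ((x r)\<^sup>2 * exp (2 * H * r))) has_real_derivative
        - (2 * (x r)\<^sup>2 * exp (2 * H * r) * (h r + H))) (at r within {t0..s})"
      by (auto intro!: derivative_eq_intros simp: power2_eq_square algebra_simps)
    show "- (2 * (x r)\<^sup>2 * exp (2 * H * r) * (h r + H)) \<le> 0"
      using h[of r] by (auto intro!: mult_nonneg_nonneg)
  qed
  moreover have "(x t0)\<^sup>2 * exp (2 * H * t0) > 0"
    using assms(3) by simp
  ultimately show False using s(3) by simp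
qed

subsection \<open>Functions that are Lipschitz on bounded sets\<close>

text \<open>Bounded sets instead of neighbourhoods: images of bounded sets are again bounded, so the
  property passes through compositions and products, and together with bounded support it gives a
  global Lipschitz constant.\<close>

definition lipschitz_on_bounded :: "('a::metric_space \<Rightarrow> 'b::metric_space) \<Rightarrow> bool" where
  "lipschitz_on_bounded f \<longleftrightarrow> (\<forall>S. bounded S \<longrightarrow> (\<exists>L. L-lipschitz_on S f))"

named_theorems lipschitz_on_bounded_intros

lemma lipschitz_on_bounded_image:
  assumes "lipschitz_on_bounded f" "bounded S"
  shows "bounded (f ` S)"
proof (cases "S = {}")
  case False
  then obtain x where x: "x \<in> S" by auto
  obtain L where L: "L-lipschitz_on S f" using assms by (auto simp: lipschitz_on_bounded_def)
  obtain e where e: "\<forall>y\<in>S. dist x y \<le> e" using assms(2) bounded_any_center by blast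
  have "dist (f x) (f y) \<le> L * e" if "y \<in> S" for y
    using lipschitz_onD[OF L x that] mult_left_mono[OF _ lipschitz_on_nonneg[OF L], of "dist x y" e] e that
    by auto
  then show ?thesis
    unfolding bounded_def by (intro exI[of _ "f x"] exI[of _ "L * e"]) auto
qed simp

lemma lipschitz_on_boundedI: "L-lipschitz_on UNIV f \<Longrightarrow> lipschitz_on_bounded f"
  unfolding lipschitz_on_bounded_def by (intro allI impI exI) (rule lipschitz_on_subset, auto)

lemma lipschitz_on_bounded_const [lipschitz_on_bounded_intros]: "lipschitz_on_bounded (\<lambda>x. c)"
  by (rule lipschitz_on_boundedI[OF lipschitz_on_constant])

lemma lipschitz_on_bounded_id [lipschitz_on_bounded_intros]: "lipschitz_on_bounded (\<lambda>x. x)"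
  by (rule lipschitz_on_boundedI[OF lipschitz_on_id])

lemma lipschitz_on_bounded_compose:
  assumes "lipschitz_on_bounded g" "lipschitz_on_bounded f"
  shows "lipschitz_on_bounded (\<lambda>x::'a::metric_space. g (f x))"
  unfolding lipschitz_on_bounded_def
proof (intro allI impI)
  fix S :: "'a set" assume S: "bounded S"
  obtain L where L: "L-lipschitz_on S f"
    using assms(2) S by (auto simp: lipschitz_on_bounded_def)
  obtain M where M: "M-lipschitz_on (f ` S) g"
    using assms(1) lipschitz_on_bounded_image[OF assms(2) S] by (auto simp: lipschitz_on_bounded_def)
  show "\<exists>L. L-lipschitz_on S (\<lambda>x. g (f x))"
    using lipschitz_on_compose2[OF L M] by blast
qed

lemma lipschitz_on_bounded_combine:
  assumes "lipschitz_on_bounded f" "lipschitz_on_bounded g"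
    and "\<And>S L M. L-lipschitz_on S f \<Longrightarrow> M-lipschitz_on S g \<Longrightarrow> \<exists>K. K-lipschitz_on S h"
  shows "lipschitz_on_bounded h"
  using assms unfolding lipschitz_on_bounded_def by meson

lemma lipschitz_on_bounded_Pair [lipschitz_on_bounded_intros]:
  assumes "lipschitz_on_bounded f" "lipschitz_on_bounded g"
  shows "lipschitz_on_bounded (\<lambda>x. (f x, g x))"
  by (rule lipschitz_on_bounded_combine[OF assms]) (rule exI, rule lipschitz_on_Pair)

lemma lipschitz_on_bounded_fst [lipschitz_on_bounded_intros]:
  assumes "lipschitz_on_bounded f" shows "lipschitz_on_bounded (\<lambda>x. fst (f x))"
  by (rule lipschitz_on_bounded_compose[OF lipschitz_on_boundedI assms, of 1])
     (simp add: lipschitz_on_def dist_fst_le)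

lemma lipschitz_on_bounded_snd [lipschitz_on_bounded_intros]:
  assumes "lipschitz_on_bounded f" shows "lipschitz_on_bounded (\<lambda>x. snd (f x))"
  by (rule lipschitz_on_bounded_compose[OF lipschitz_on_boundedI assms, of 1])
     (simp add: lipschitz_on_def dist_snd_le)

lemma lipschitz_on_bounded_add [lipschitz_on_bounded_intros]:
  fixes f g :: "'a::metric_space \<Rightarrow> 'b::real_normed_vector"
  assumes "lipschitz_on_bounded f" "lipschitz_on_bounded g"
  shows "lipschitz_on_bounded (\<lambda>x. f x + g x)"
  by (rule lipschitz_on_bounded_combine[OF assms]) (rule exI, rule lipschitz_on_add)

lemma lipschitz_on_bounded_diff [lipschitz_on_bounded_intros]:
  fixes f g :: "'a::metric_space \<Rightarrow> 'b::real_normed_vector"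
  assumes "lipschitz_on_bounded f" "lipschitz_on_bounded g"
  shows "lipschitz_on_bounded (\<lambda>x. f x - g x)"
  by (rule lipschitz_on_bounded_combine[OF assms]) (rule exI, rule lipschitz_on_diff)

lemma lipschitz_on_bounded_scaleR [lipschitz_on_bounded_intros]:
  fixes f :: "'a::metric_space \<Rightarrow> real" and g :: "'a \<Rightarrow> 'b::real_normed_vector"
  assumes f: "lipschitz_on_bounded f" and g: "lipschitz_on_bounded g"
  shows "lipschitz_on_bounded (\<lambda>x. f x *\<^sub>R g x)"
  unfolding lipschitz_on_bounded_def
proof (intro allI impI)
  fix S :: "'a set" assume S: "bounded S"
  obtain L M where L: "L-lipschitz_on S f" and M: "M-lipschitz_on S g"
    using f g S unfolding lipschitz_on_bounded_def by meson
  obtain A B where A: "\<And>x. x \<in> S \<Longrightarrow> \<bar>f x\<bar> \<le> A" "A > 0"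
      and B: "\<And>x. x \<in> S \<Longrightarrow> norm (g x) \<le> B" "B > 0"
    using lipschitz_on_bounded_image[OF f S] lipschitz_on_bounded_image[OF g S]
    unfolding bounded_pos by auto
  have "(A * M + B * L)-lipschitz_on S (\<lambda>x. f x *\<^sub>R g x)"
  proof (rule lipschitz_onI)
    fix x y assume x: "x \<in> S" "y \<in> S"
    have "f x *\<^sub>R g x - f y *\<^sub>R g y = f x *\<^sub>R (g x - g y) + (f x - f y) *\<^sub>R g y"
      by (simp add: algebra_simps)
    then have "dist (f x *\<^sub>R g x) (f y *\<^sub>R g y) \<le> \<bar>f x\<bar> * norm (g x - g y) + \<bar>f x - f y\<bar> * norm (g y)"
      by (simp add: dist_norm norm_triangle_le)
    also have "\<dots> \<le> A * (M * dist x y) + (L * dist x y) * B"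
      using A B x lipschitz_onD[OF L x] lipschitz_onD[OF M x] lipschitz_on_nonneg[OF L]
      by (intro add_mono mult_mono) (auto simp: dist_norm)
    finally show "dist (f x *\<^sub>R g x) (f y *\<^sub>R g y) \<le> (A * M + B * L) * dist x y"
      by (simp add: algebra_simps)
  qed (use A B lipschitz_on_nonneg[OF L] lipschitz_on_nonneg[OF M] in simp)
  then show "\<exists>L. L-lipschitz_on S (\<lambda>x. f x *\<^sub>R g x)" by blast
qed

lemma lipschitz_on_bounded_mult [lipschitz_on_bounded_intros]:
  fixes f g :: "'a::metric_space \<Rightarrow> real"
  assumes "lipschitz_on_bounded f" "lipschitz_on_bounded g"
  shows "lipschitz_on_bounded (\<lambda>x. f x * g x)"
  using lipschitz_on_bounded_scaleR[OF assms] by simp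

lemma lipschitz_on_bounded_power [lipschitz_on_bounded_intros]:
  fixes f :: "'a::metric_space \<Rightarrow> real"
  assumes "lipschitz_on_bounded f"
  shows "lipschitz_on_bounded (\<lambda>x. f x ^ n)"
proof (induction n)
  case 0
  show ?case by (simp add: lipschitz_on_bounded_const)
next
  case (Suc n)
  then show ?case by (simp add: lipschitz_on_bounded_mult assms)
qed

text \<open>The closure of a bounded set is compact, so a continuous function without zeros has a
  bounded reciprocal there; the difference of two reciprocals then costs the square of that
  bound.\<close>

lemma lipschitz_on_bounded_inverse:
  fixes f :: "'a::heine_borel \<Rightarrow> real"
  assumes f: "lipschitz_on_bounded f" and nz: "\<And>x. f x \<noteq> 0"
  shows "lipschitz_on_bounded (\<lambda>x. inverse (f x))"
  unfolding lipschitz_on_bounded_def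
proof (intro allI impI)
  fix S :: "'a set" assume S: "bounded S"
  define C where "C = closure S"
  have C: "bounded C" "compact C" "S \<subseteq> C"
    using S by (auto simp: C_def closure_subset compact_closure)
  obtain L where L: "L-lipschitz_on C f"
    using f C by (auto simp: lipschitz_on_bounded_def)
  have "continuous_on C (\<lambda>x. inverse (f x))"
    using lipschitz_on_continuous_on[OF L] nz by (auto intro!: continuous_intros)
  then have "bounded ((\<lambda>x. inverse (f x)) ` C)"
    using C(2) compact_continuous_image compact_imp_bounded by blast
  then obtain m where m: "m > 0" "\<And>x. x \<in> C \<Longrightarrow> \<bar>inverse (f x)\<bar> \<le> m"
    unfolding bounded_pos by auto
  have "(m * m * L)-lipschitz_on S (\<lambda>x. inverse (f x))"
  proof (rule lipschitz_onI)
    fix x y assume "x \<in> S" "y \<in> S"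
    then have x: "x \<in> C" "y \<in> C" using C by auto
    have "dist (inverse (f x)) (inverse (f y)) = \<bar>inverse (f x)\<bar> * \<bar>inverse (f y)\<bar> * \<bar>f x - f y\<bar>"
      using nz[of x] nz[of y] by (simp add: dist_real_def inverse_diff_inverse abs_mult)
    also have "\<dots> \<le> m * m * (L * dist x y)"
      using m x lipschitz_onD[OF L x] by (intro mult_mono) (auto simp: dist_real_def)
    finally show "dist (inverse (f x)) (inverse (f y)) \<le> m * m * L * dist x y" by simp
  qed (use m lipschitz_on_nonneg[OF L] in simp)
  then show "\<exists>L. L-lipschitz_on S (\<lambda>x. inverse (f x))" by blast
qed

lemma lipschitz_on_bounded_divide [lipschitz_on_bounded_intros]:
  fixes f g :: "'a::heine_borel \<Rightarrow> real"
  assumes "lipschitz_on_bounded f" "lipschitz_on_bounded g" "\<And>x. g x \<noteq> 0"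
  shows "lipschitz_on_bounded (\<lambda>x. f x / g x)"
  unfolding divide_inverse
  by (intro lipschitz_on_bounded_mult lipschitz_on_bounded_inverse assms)

section \<open>Elementary functions with Lipschitz constant 1\<close>

lemma abs_diff_le_of_deriv_bound:
  fixes f :: "real \<Rightarrow> real"
  assumes "\<And>x. (f has_real_derivative f' x) (at x)" "\<And>x. \<bar>f' x\<bar> \<le> 1"
  shows "\<bar>f x - f y\<bar> \<le> \<bar>x - y\<bar>"
  using field_differentiable_bound[of UNIV f f' 1 x y] assms
  by (simp add: has_field_derivative_at_within)

lemma abs_sin_diff_le: "\<bar>sin x - sin y\<bar> \<le> \<bar>x - y\<bar>" for x y :: real
  by (rule abs_diff_le_of_deriv_bound[of _ cos]) (auto intro!: derivative_eq_intros)

lemma abs_cos_diff_le: "\<bar>cos x - cos y\<bar> \<le> \<bar>x - y\<bar>" for x y :: real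
  by (rule abs_diff_le_of_deriv_bound[of _ "\<lambda>x. - sin x"]) (auto intro!: derivative_eq_intros)

lemma abs_arctan_diff_le: "\<bar>arctan x - arctan y\<bar> \<le> \<bar>x - y\<bar>"
  by (rule abs_diff_le_of_deriv_bound[of _ "\<lambda>x. inverse (1 + x\<^sup>2)"])
     (auto intro!: derivative_eq_intros simp: field_simps add_pos_nonneg)

lemma abs_arctan_le: "\<bar>arctan x\<bar> \<le> \<bar>x\<bar>"
  using abs_arctan_diff_le[of x 0] by simp

lemma lipschitz_on_bounded_real_compose:
  fixes f :: "'a::metric_space \<Rightarrow> real" and g :: "real \<Rightarrow> real"
  assumes "\<And>x y. \<bar>g x - g y\<bar> \<le> \<bar>x - y\<bar>" "lipschitz_on_bounded f"
  shows "lipschitz_on_bounded (\<lambda>x. g (f x))"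
  by (rule lipschitz_on_bounded_compose[OF lipschitz_on_boundedI assms(2), of 1])
     (simp add: lipschitz_on_def dist_real_def assms(1))

lemmas lipschitz_on_bounded_sin [lipschitz_on_bounded_intros] = lipschitz_on_bounded_real_compose[OF abs_sin_diff_le]
  and lipschitz_on_bounded_cos [lipschitz_on_bounded_intros] = lipschitz_on_bounded_real_compose[OF abs_cos_diff_le]
  and lipschitz_on_bounded_arctan [lipschitz_on_bounded_intros] = lipschitz_on_bounded_real_compose[OF abs_arctan_diff_le]

text \<open>The summand 1 keeps the argument away from 0, where \<open>sqrt\<close> is not
  Lipschitz. Clamping with \<open>max 0\<close> gives a 1-Lipschitz function on the whole line that
  agrees with the required one on the values of \<open>f\<close>.\<close>

lemma lipschitz_on_bounded_sqrt [lipschitz_on_bounded_intros]: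
  fixes f :: "'a::metric_space \<Rightarrow> real"
  assumes "lipschitz_on_bounded f" "\<And>x. f x \<ge> 0"
  shows "lipschitz_on_bounded (\<lambda>x. sqrt (1 + f x))"
proof -
  have "\<bar>sqrt (1 + max 0 x) - sqrt (1 + max 0 y)\<bar> \<le> \<bar>x - y\<bar>" for x y :: real
  proof -
    define p q where "p = sqrt (1 + max 0 x)" and "q = sqrt (1 + max 0 y)"
    have pq: "p \<ge> 1" "q \<ge> 1" by (auto simp: p_def q_def)
    have "\<bar>p - q\<bar> * 1 \<le> \<bar>p - q\<bar> * (p + q)" using pq by (intro mult_left_mono) auto
    also have "\<dots> = \<bar>p\<^sup>2 - q\<^sup>2\<bar>"
      using pq by (simp add: power2_eq_square square_diff_square_factored abs_mult)
    also have "\<dots> \<le> \<bar>x - y\<bar>" by (simp add: p_def q_def)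
    finally show ?thesis by (simp add: p_def q_def)
  qed
  from lipschitz_on_bounded_real_compose[OF this assms(1)] show ?thesis
    using assms(2) by (simp add: max_def)
qed

text \<open>Inside a ball slightly larger than the support the local constant applies. If one point
  lies outside it and \<open>f\<close> does not vanish at the other, the two are at least 1 apart,
  and the supremum of \<open>f\<close> serves as Lipschitz constant.\<close>

lemma lipschitz_of_bounded_support:
  fixes f :: "'a::real_normed_vector \<Rightarrow> 'b::real_normed_vector"
  assumes f: "lipschitz_on_bounded f" and supp: "\<And>x. f x \<noteq> 0 \<Longrightarrow> norm x \<le> R"
  shows "\<exists>L M. L-lipschitz_on UNIV f \<and> (\<forall>x. norm (f x) \<le> M)"
proof -
  \<comment> \<open>The margin 1 is the distance from the support that makes
    \<open>dist x y \<ge> 1\<close> below.\<close>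
  define S where "S = cball (0::'a) (R + 1)"
  have S: "bounded S" by (simp add: S_def)
  obtain L where L: "L-lipschitz_on S f" using f S by (auto simp: lipschitz_on_bounded_def)
  obtain M where M: "M > 0" "\<And>x. x \<in> S \<Longrightarrow> norm (f x) \<le> M"
    using lipschitz_on_bounded_image[OF f S] unfolding bounded_pos by auto
  have M': "norm (f x) \<le> M" for x
  proof (cases "f x = 0")
    case False
    then have "x \<in> S" using supp[of x] by (simp add: S_def)
    then show ?thesis by (rule M)
  qed (use M in simp)
  have far: "dist (f x) (f y) \<le> M * dist x y" if "y \<notin> S" for x y
  proof (cases "f x = 0")
    case False
    have fy: "f y = 0" using that supp[of y] by (auto simp: S_def)
    have "norm y > R + 1" using that by (auto simp: S_def)
    then have "dist x y \<ge> 1"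
      using supp[OF False] norm_triangle_ineq2[of y x] by (simp add: dist_norm norm_minus_commute)
    then have "M * 1 \<le> M * dist x y" using M by (intro mult_left_mono) auto
    then show ?thesis using M'[of x] fy by (simp add: dist_norm)
  next
    case True
    have "f y = 0" using that supp[of y] by (auto simp: S_def)
    then show ?thesis using True M by simp
  qed
  have "(L + M)-lipschitz_on UNIV f"
  proof (rule lipschitz_onI)
    fix x y :: 'a
    have nn: "L * dist x y \<ge> 0" "M * dist x y \<ge> 0" using lipschitz_on_nonneg[OF L] M by auto
    consider "x \<in> S" "y \<in> S" | "y \<notin> S" | "x \<notin> S" by blast
    then have "dist (f x) (f y) \<le> L * dist x y + M * dist x y"
    proof cases
      case 1 then show ?thesis using lipschitz_onD[OF L 1] nn by linarith
    next
      case 2 then show ?thesis using far[of y x] nn by linarith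
    next
      case 3 then show ?thesis using far[of x y] nn by (metis add_increasing dist_commute)
    qed
    then show "dist (f x) (f y) \<le> (L + M) * dist x y" by (simp add: algebra_simps)
  qed (use M lipschitz_on_nonneg[OF L] in simp)
  then show ?thesis using M' by blast
qed

text \<open>The integral over the unit interval absorbs the removable singularity at
  \<open>a = 0\<close>, so that joint Lipschitz continuity in \<open>a\<close> and \<open>b\<close>
  can be read off the integrand. The same is done for \<open>sigma2\<close> with
  \<open>sin\<close>.\<close>

lemma sigma1_has_integral: "((\<lambda>s. cos (s * a - b)) has_integral sigma1 a b) {0..1}"
proof (cases "a = 0")
  case True
  then show ?thesis using has_integral_const_real[of "cos b" 0 1] by (simp add: sigma1_def)
next
  case False
  then have "((\<lambda>s. cos (s * a - b)) has_integral (sin (1 * a - b) / a - sin (0 * a - b) / a)) {0..1}"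
    by (intro fundamental_theorem_of_calculus)
       (auto intro!: derivative_eq_intros simp flip: has_real_derivative_iff_has_vector_derivative)
  then show ?thesis using False by (simp add: sigma1_def add_divide_distrib)
qed

lemma sigma2_has_integral: "((\<lambda>s. sin (s * a - b)) has_integral sigma2 a b) {0..1}"
proof (cases "a = 0")
  case True
  then show ?thesis using has_integral_const_real[of "- sin b" 0 1] by (simp add: sigma2_def)
next
  case False
  then have "((\<lambda>s. sin (s * a - b)) has_integral (- cos (1 * a - b) / a - - cos (0 * a - b) / a)) {0..1}"
    by (intro fundamental_theorem_of_calculus)
       (auto intro!: derivative_eq_intros simp flip: has_real_derivative_iff_has_vector_derivative)
  then show ?thesis using False by (simp add: sigma2_def diff_divide_distrib)
qed

text \<open>For \<open>s\<close> between 0 and 1 the argument \<open>s * a - b\<close> moves by at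
  most \<open>\<bar>a - a'\<bar> + \<bar>b - b'\<bar>\<close>, and averaging preserves this
  bound.\<close>

lemma averaged_lipschitz:
  fixes g :: "real \<Rightarrow> real"
  assumes g: "\<And>x y. \<bar>g x - g y\<bar> \<le> \<bar>x - y\<bar>"
    and h: "\<And>a b. ((\<lambda>s. g (s * a - b)) has_integral h a b) {0..1}"
  shows "\<bar>h a b - h a' b'\<bar> \<le> \<bar>a - a'\<bar> + \<bar>b - b'\<bar>"
proof -
  have i: "((\<lambda>s. g (s * a - b) - g (s * a' - b')) has_integral (h a b - h a' b')) (cbox 0 1)"
    using has_integral_diff[OF h h, of a b a' b'] by simp
  have le: "norm (g (s * a - b) - g (s * a' - b')) \<le> \<bar>a - a'\<bar> + \<bar>b - b'\<bar>"
    if "s \<in> cbox 0 1" for s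
  proof -
    have "\<bar>(s * a - b) - (s * a' - b')\<bar> \<le> \<bar>s * (a - a')\<bar> + \<bar>b - b'\<bar>"
      by (simp add: algebra_simps abs_if)
    also have "\<dots> \<le> \<bar>a - a'\<bar> + \<bar>b - b'\<bar>"
      using that by (simp add: abs_mult mult_left_le_one_le)
    finally show ?thesis
      using g[of "s * a - b" "s * a' - b'"] by simp
  qed
  show ?thesis
    using has_integral_bound[OF _ i le] by simp
qed

lemma lipschitz_on_bounded_averaged:
  fixes f g :: "'a::metric_space \<Rightarrow> real"
  assumes h: "\<And>a b a' b'. \<bar>h a b - h a' b'\<bar> \<le> \<bar>a - a'\<bar> + \<bar>b - b' :: real\<bar>"
    and "lipschitz_on_bounded f" "lipschitz_on_bounded g"
  shows "lipschitz_on_bounded (\<lambda>x. h (f x) (g x) :: real)"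
proof -
  have "2-lipschitz_on UNIV (\<lambda>p. h (fst p) (snd p))"
  proof (rule lipschitz_onI)
    fix x y :: "real \<times> real"
    show "dist (h (fst x) (snd x)) (h (fst y) (snd y)) \<le> 2 * dist x y"
      using h[of "fst x" "snd x" "fst y" "snd y"] dist_fst_le[of x y] dist_snd_le[of x y]
      by (simp add: dist_real_def)
  qed simp
  from lipschitz_on_bounded_compose[OF lipschitz_on_boundedI[OF this] lipschitz_on_bounded_Pair[OF assms(2,3)]]
  show ?thesis by simp
qed

lemmas lipschitz_on_bounded_sigma1 [lipschitz_on_bounded_intros] =
    lipschitz_on_bounded_averaged[OF averaged_lipschitz[OF abs_cos_diff_le sigma1_has_integral]]
  and lipschitz_on_bounded_sigma2 [lipschitz_on_bounded_intros] =
    lipschitz_on_bounded_averaged[OF averaged_lipschitz[OF abs_sin_diff_le sigma2_has_integral]]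

subsection \<open>The Lyapunov function\<close>

lemma has_vector_derivative_tuple5D:
  assumes "(f has_vector_derivative (a, b, c, d, e :: real)) (at t within S)"
  shows "((\<lambda>t. fst (f t)) has_vector_derivative a) (at t within S)"
    "((\<lambda>t. fst (snd (f t))) has_vector_derivative b) (at t within S)"
    "((\<lambda>t. fst (snd (snd (f t)))) has_vector_derivative c) (at t within S)"
    "((\<lambda>t. fst (snd (snd (snd (f t))))) has_vector_derivative d) (at t within S)"
    "((\<lambda>t. snd (snd (snd (snd (f t))))) has_vector_derivative e) (at t within S)"
proof -
  note D = bounded_linear.has_vector_derivative[OF _ assms]
  note s2 = bounded_linear_snd_comp[OF bounded_linear_snd]
  note s3 = bounded_linear_snd_comp[OF s2]
  show "((\<lambda>t. fst (f t)) has_vector_derivative a) (at t within S)"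
    using D[OF bounded_linear_fst] by simp
  show "((\<lambda>t. fst (snd (f t))) has_vector_derivative b) (at t within S)"
    using D[OF bounded_linear_fst_comp[OF bounded_linear_snd]] by simp
  show "((\<lambda>t. fst (snd (snd (f t)))) has_vector_derivative c) (at t within S)"
    using D[OF bounded_linear_fst_comp[OF s2]] by simp
  show "((\<lambda>t. fst (snd (snd (snd (f t))))) has_vector_derivative d) (at t within S)"
    using D[OF bounded_linear_fst_comp[OF s3]] by simp
  show "((\<lambda>t. snd (snd (snd (snd (f t))))) has_vector_derivative e) (at t within S)"
    using D[OF bounded_linear_snd_comp[OF s3]] by simp
qed

section \<open>Algebra of the closed loop: dissipative parts and cross terms\<close>

lemma cos_sigma2: "cos b = cos (a - b) + a * sigma2 a b"
  by (simp add: sigma2_def)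

lemma sin_sigma1: "sin b = - sin (a - b) + a * sigma1 a b"
  by (simp add: sigma1_def)

text \<open>Read \<open>c\<close>, \<open>s\<close> as cosine and sine of \<open>\<zeta>\<close>,
  and \<open>ct\<close>, \<open>st\<close>, \<open>cg\<close> as \<open>cos \<theta>\<close>,
  \<open>sin \<theta>\<close>, \<open>cos \<gamma>\<close>, already split by the
  \<open>\<sigma>\<close> identities. On \<open>e1 = e2 = 0\<close> the choice of
  \<open>\<eta>\<close> leaves \<open>N \<eta> s + c = k3 s\<^sup>2 + 1 / c\<close>. Products
  \<open>e1 e2\<close> are booked under \<open>e1\<close>, which explains the summands with
  \<open>e2\<close> inside the \<open>\<rho>\<close>, \<open>\<delta>\<close> and
  \<open>\<zeta>\<close> terms of the yaw feedback.\<close>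

lemma decay_rho:
  fixes c s N B \<eta> :: real
  assumes "c > 0" "N > 0" "B > 0" "s\<^sup>2 + c\<^sup>2 = 1" "\<eta> = (k3 * s + s / c) / N"
    and ct: "ct = 1 / B + e2 * T2" and st: "st = - \<eta> / B + e2 * T1" and cg: "cg = 1 / N + e1 * S2"
  shows "r * (k1 * r * N * B * (st * s - ct * c * cg)) =
    - k1 * r\<^sup>2 * (k3 * s\<^sup>2 + 1 / c)
    + e2 * (k1 * r\<^sup>2 * B * (s * T1 * N - c * T2))
    - e1 * (k1 * r\<^sup>2 * c * N * (S2 + e2 * S2 * T2 * B))"
proof -
  have "N * B * (st * s - ct * c * cg) =
     - (N * \<eta> * s + c) + e2 * (B * (s * T1 * N - c * T2)) - e1 * (c * N * (S2 + e2 * S2 * T2 * B))"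
    using assms(2,3) by (simp add: ct st cg field_simps)
  also have "N * \<eta> * s + c = k3 * s\<^sup>2 + (s\<^sup>2 + c\<^sup>2) / c"
    using assms(1-3) by (simp add: assms(5) field_simps power2_eq_square)
  finally have *: "N * B * (st * s - ct * c * cg) = - (k3 * s\<^sup>2 + 1 / c)
      + e2 * (B * (s * T1 * N - c * T2)) - e1 * (c * N * (S2 + e2 * S2 * T2 * B))"
    using assms(4) by simp
  have "r * (k1 * r * N * B * (st * s - ct * c * cg)) = k1 * r\<^sup>2 * (N * B * (st * s - ct * c * cg))"
    by (simp add: power2_eq_square)
  then show ?thesis unfolding * by (simp add: algebra_simps)
qed

lemma decay_delta:
  fixes c N B :: real
  assumes "c > 0" "N > 0" "B > 0"
    and ct: "ct = 1 / B + e2 * T2" and sg: "sg = - (k2 * d * c) / N + e1 * S1"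
  shows "d * (k1 * N * B * ct / c * sg) =
    - k1 * k2 * d\<^sup>2 - e2 * (k1 * k2 * d\<^sup>2 * T2 * B)
    + e1 * (k1 * d * S1 * N / c * (1 + e2 * T2 * B))"
  using assms(1-3) by (simp add: ct sg field_simps power2_eq_square)

text \<open>This is half the derivative of \<open>tan\<^sup>2 \<zeta>\<close>. The summand
  \<open>tan \<zeta>\<close> of the numerator of \<open>\<eta>\<close> cancels the destabilising
  \<open>sin \<zeta>\<close>, and the summand \<open>k3 sin \<zeta>\<close> supplies the
  decay.\<close>

lemma decay_zeta:
  fixes c s N B \<eta> :: real
  assumes "c > 0" "N > 0" "B > 0" "\<eta> = (k3 * s + s / c) / N"
    and ct: "ct = 1 / B + e2 * T2" and st: "st = - \<eta> / B + e2 * T1" and cg: "cg = 1 / N + e1 * S2"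
  shows "s / c * ((k1 * N * B * (ct * s * cg + st * c)) / c\<^sup>2) =
    - k1 * k3 * (s / c)\<^sup>2
    + e2 * (k1 * (s / c) * B / c\<^sup>2 * (s * T2 + c * T1 * N))
    + e1 * (k1 * (s / c) * N / c\<^sup>2 * s * (S2 + e2 * S2 * T2 * B))"
proof -
  have "N * B * (ct * s * cg + st * c) =
     (s - N * \<eta> * c) + e2 * (B * (s * T2 + c * T1 * N)) + e1 * (N * s * (S2 + e2 * S2 * T2 * B))"
    using assms(2,3) by (simp add: ct st cg field_simps)
  also have "s - N * \<eta> * c = - k3 * s * c"
    using assms(1-3) by (simp add: assms(4) field_simps)
  finally have *: "N * B * (ct * s * cg + st * c) = - k3 * s * c
      + e2 * (B * (s * T2 + c * T1 * N)) + e1 * (N * s * (S2 + e2 * S2 * T2 * B))" .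
  define X where "X = k1 * (s / c) / c\<^sup>2"
  have X: "X * (k3 * s * c) = k1 * k3 * (s / c)\<^sup>2"
    using assms(1) by (simp add: X_def field_simps power2_eq_square)
  have "s / c * ((k1 * N * B * (ct * s * cg + st * c)) / c\<^sup>2) = X * (N * B * (ct * s * cg + st * c))"
    by (simp add: X_def)
  also have "\<dots> = - (X * (k3 * s * c))
      + e2 * (X * B * (s * T2 + c * T1 * N)) + e1 * (X * N * s * (S2 + e2 * S2 * T2 * B))"
    unfolding * by (simp add: algebra_simps)
  finally show ?thesis unfolding X by (simp add: X_def)
qed

text \<open>The left side is the derivative of \<open>arctan \<eta>\<close> along the closed loop,
  by the quotient rule and \<open>1 + \<eta>\<^sup>2 = B\<^sup>2\<close>. The expression
  \<open>C\<close> is what the coefficient of \<open>Z\<close> becomes after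
  \<open>s\<^sup>2 + c\<^sup>2 = 1\<close>. The result is minus the large bracket in the pitch
  feedback, which is thus pure feedforward.\<close>

lemma decay_e2:
  fixes c s N B \<eta> d :: real
  assumes "c > 0" "N > 0" "B > 0" "s\<^sup>2 + c\<^sup>2 = 1" "N\<^sup>2 = 1 + k2\<^sup>2 * d\<^sup>2 * c\<^sup>2"
    and C: "C = 1 + k3 * c + (s / c)\<^sup>2 + k2\<^sup>2 * d\<^sup>2 * (2 + k3 * c - c\<^sup>2)"
  shows "((k3 * c + 1 / c\<^sup>2) * (k1 * N * B * Z) * N
        - (k3 * s + s / c) * (k2\<^sup>2 * (d * (k1 * N * B * ct / c * sg) * c\<^sup>2
            - d\<^sup>2 * c * s * (k1 * N * B * Z)) / N)) / N\<^sup>2 / B\<^sup>2 =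
    - (k1 / (N\<^sup>2 * B) * (k2\<^sup>2 * d * ct * c * sg * (k3 * s + s / c) - Z * C))"
proof -
  have "(k3 * c + 1 / c\<^sup>2) * N\<^sup>2 + (k3 * s + s / c) * (k2\<^sup>2 * d\<^sup>2 * c * s) =
      (k3 * c + (s\<^sup>2 + c\<^sup>2) / c\<^sup>2) * (1 + k2\<^sup>2 * d\<^sup>2 * c\<^sup>2) + (k3 * s + s / c) * (k2\<^sup>2 * d\<^sup>2 * c * s)"
    using assms(4,5) by simp
  also have "\<dots> = 1 + k3 * c + (s / c)\<^sup>2
      + k2\<^sup>2 * d\<^sup>2 * ((s\<^sup>2 + c\<^sup>2) * (k3 * c + 1) + s\<^sup>2)"
    using assms(1) by (simp add: field_simps power2_eq_square)
  also have "(s\<^sup>2 + c\<^sup>2) * (k3 * c + 1) + s\<^sup>2 = 2 + k3 * c - c\<^sup>2"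
    using assms(4) by simp
  finally have C': "(k3 * c + 1 / c\<^sup>2) * N\<^sup>2 + (k3 * s + s / c) * (k2\<^sup>2 * d\<^sup>2 * c * s) = C"
    unfolding C .
  define p where "p = k3 * s + s / c"
  define w where "w = k3 * c + 1 / c\<^sup>2"
  have "(w * (k1 * N * B * Z) * N - p * (k2\<^sup>2 * (d * (k1 * N * B * ct / c * sg) * c\<^sup>2
            - d\<^sup>2 * c * s * (k1 * N * B * Z)) / N)) / N\<^sup>2 / B\<^sup>2 =
      k1 / (N\<^sup>2 * B) * (Z * (w * N\<^sup>2 + p * (k2\<^sup>2 * d\<^sup>2 * c * s)) - k2\<^sup>2 * d * ct * c * sg * p)"
    using assms(1-3) by (simp add: field_simps power2_eq_square)
  also have "w * N\<^sup>2 + p * (k2\<^sup>2 * d\<^sup>2 * c * s) = C"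
    using C' unfolding p_def w_def .
  also have "k1 / (N\<^sup>2 * B) * (Z * C - k2\<^sup>2 * d * ct * c * sg * p) =
      - (k1 / (N\<^sup>2 * B) * (k2\<^sup>2 * d * ct * c * sg * p - Z * C))"
    by (simp add: right_diff_distrib)
  finally show ?thesis unfolding p_def w_def .
qed

locale gains =
  fixes k1 k2 k3 k4 k5 :: real
  assumes gains_pos: "k1 > 0" "k2 > 0" "k3 > 0" "k4 > 0" "k5 > 0"
begin

text \<open>With \<open>tan \<zeta>\<close> in place of \<open>\<zeta>\<close> a bound on this
  function keeps \<open>\<zeta>\<close> away from \<open>pi / 2\<close> and matches the term in
  \<open>norm_D\<close>.\<close>

definition lyap :: "state \<Rightarrow> real" where
  "lyap s = (fst s)\<^sup>2 + (fst (snd s))\<^sup>2 + (tan (fst (snd (snd (snd s)))))\<^sup>2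
     + (aux_e1 k2 s)\<^sup>2 + (aux_e2 k2 k3 s)\<^sup>2"

text \<open>Minus half the derivative of \<open>lyap\<close> along the closed loop.\<close>

definition dissipation :: "state \<Rightarrow> real" where
  "dissipation s = (case s of (\<rho>, \<delta>, \<gamma>, \<zeta>, \<theta>) \<Rightarrow>
     k1 * \<rho>\<^sup>2 * (k3 * (sin \<zeta>)\<^sup>2 + 1 / cos \<zeta>) + k1 * k2 * \<delta>\<^sup>2 + k1 * k3 * (tan \<zeta>)\<^sup>2
     + k4 * (aux_e1 k2 s)\<^sup>2 + k5 * (aux_e2 k2 k3 s)\<^sup>2)"

text \<open>The scalar \<open>\<mu>\<close> lets one computation serve twice:
  \<open>\<mu> = 1\<close> for true solutions, and the value of the cutoff for the modified field in
  the existence proof. Since the derivative of \<open>lyap\<close> is linear in the field,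
  \<open>\<mu>\<close> just factors out.\<close>

lemma lyap_deriv:
  assumes f: "(f has_vector_derivative \<mu> *\<^sub>R spherical_field k1 k2 k3 k4 k5 (f t)) (at t within S)"
    and st: "f t \<in> state_space"
  shows "((\<lambda>t. lyap (f t)) has_real_derivative - (2 * \<mu> * dissipation (f t))) (at t within S)"
proof -
  define \<rho> \<delta> \<gamma> \<zeta> \<theta> where
    "\<rho> = (\<lambda>t. fst (f t))" and "\<delta> = (\<lambda>t. fst (snd (f t)))" and "\<gamma> = (\<lambda>t. fst (snd (snd (f t))))"
    and "\<zeta> = (\<lambda>t. fst (snd (snd (snd (f t)))))" and "\<theta> = (\<lambda>t. snd (snd (snd (snd (f t)))))"
  note defs = \<rho>_def \<delta>_def \<gamma>_def \<zeta>_def \<theta>_def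
  have ft: "f u = (\<rho> u, \<delta> u, \<gamma> u, \<zeta> u, \<theta> u)" for u
    by (simp add: defs)
  obtain F1 F2 F3 F4 F5 where F: "spherical_field k1 k2 k3 k4 k5 (f t) = (F1, F2, F3, F4, F5)"
    using prod_cases5 by blast
  note fv = f[unfolded F]
  note D = has_vector_derivative_tuple5D[OF fv[unfolded scaleR_Pair real_scaleR_def], folded defs,
      folded has_real_derivative_iff_has_vector_derivative]
  note d1 = D(1) and d2 = D(2) and d3 = D(3) and d4 = D(4) and d5 = D(5)
  define c s r d where "c = cos (\<zeta> t)" and "s = sin (\<zeta> t)" and "r = \<rho> t" and "d = \<delta> t"
  define N \<eta> B e1 e2 where "N = aux_N k2 (f t)" and "\<eta> = aux_eta k2 k3 (f t)"
    and "B = aux_B k2 k3 (f t)" and "e1 = aux_e1 k2 (f t)" and "e2 = aux_e2 k2 k3 (f t)"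
  have r: "r > 0" and c: "c > 0"
    using st unfolding ft state_space_def by (auto simp: r_def c_def intro!: cos_gt_zero_pi)
  have sc: "s\<^sup>2 + c\<^sup>2 = 1" by (simp add: s_def c_def)
  have tan: "tan (\<zeta> t) = s / c" by (simp add: s_def c_def tan_def)
  have N: "N > 0" "N\<^sup>2 = 1 + k2\<^sup>2 * d\<^sup>2 * c\<^sup>2" "N = sqrt (1 + k2\<^sup>2 * d\<^sup>2 * c\<^sup>2)"
    by (auto simp: N_def aux_N_def ft d_def c_def add_pos_nonneg)
  have \<eta>: "\<eta> = (k3 * s + s / c) / N"
    by (simp add: \<eta>_def aux_eta_def ft N(3) tan d_def flip: c_def s_def)
  have B: "B > 0" "B\<^sup>2 = 1 + \<eta>\<^sup>2" "B = sqrt (1 + \<eta>\<^sup>2)"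
    by (auto simp: B_def aux_B_def \<eta>_def add_pos_nonneg)
  have e1: "e1 = \<gamma> t + arctan (k2 * d * c)"
    by (simp add: e1_def aux_e1_def ft d_def c_def)
  have e2: "e2 = \<theta> t + arctan \<eta>"
    by (simp add: e2_def aux_e2_def ft \<eta>_def)
  define S1 S2 T1 T2 where "S1 = sigma1 e1 (\<gamma> t)" and "S2 = sigma2 e1 (\<gamma> t)"
    and "T1 = sigma1 e2 (\<theta> t)" and "T2 = sigma2 e2 (\<theta> t)"
  \<comment> \<open>As \<open>e2 - \<theta> = arctan \<eta>\<close>, its cosine and sine are
    \<open>1 / B\<close> and \<open>\<eta> / B\<close>; likewise \<open>e1 - \<gamma>\<close> brings
    in \<open>N\<close>.\<close>
  have ct: "cos (\<theta> t) = 1 / B + e2 * T2"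
    using cos_sigma2[of "\<theta> t" e2] by (simp add: T2_def e2 cos_arctan B(3))
  have sth: "sin (\<theta> t) = - \<eta> / B + e2 * T1"
    using sin_sigma1[of "\<theta> t" e2] by (simp add: T1_def e2 sin_arctan B(3))
  have cg: "cos (\<gamma> t) = 1 / N + e1 * S2"
    using cos_sigma2[of "\<gamma> t" e1] by (simp add: S2_def e1 cos_arctan N(3) power_mult_distrib)
  have sg: "sin (\<gamma> t) = - (k2 * d * c) / N + e1 * S1"
    using sin_sigma1[of "\<gamma> t" e1] by (simp add: S1_def e1 sin_arctan N(3) power_mult_distrib)
  define Z where "Z = cos (\<theta> t) * s * cos (\<gamma> t) + sin (\<theta> t) * c"
  define C where "C = 1 + k3 * c + (s / c)\<^sup>2 + k2\<^sup>2 * d\<^sup>2 * (2 + k3 * c - c\<^sup>2)"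
  have v: "feedback_v k1 k2 k3 (f t) = k1 * r * N * B"
    by (simp add: feedback_v_def ft N_def B_def r_def)
  have F1: "F1 = k1 * r * N * B * (sin (\<theta> t) * s - cos (\<theta> t) * c * cos (\<gamma> t))"
    using F v by (auto simp: spherical_field_def ft Let_def s_def c_def)
  have F2: "F2 = k1 * N * B * cos (\<theta> t) / c * sin (\<gamma> t)"
    using F v r by (auto simp: spherical_field_def ft Let_def c_def r_def)
  have F3: "F3 = F2 - feedback_r_tilde k1 k2 k3 k4 (f t)"
    using F by (auto simp: spherical_field_def ft Let_def)
  have F4: "F4 = k1 * N * B * Z"
    using F v r by (auto simp: spherical_field_def ft Let_def c_def s_def Z_def r_def)
  have F5: "F5 = feedback_q k1 k2 k3 k5 (f t)"
    using F by (auto simp: spherical_field_def ft Let_def)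
  \<comment> \<open>The second summand of the feedback is the derivative of \<open>\<delta>\<close>
    itself, so \<open>F3\<close> loses its drift; the two trigonometric terms of the next bracket
    combine to \<open>s * Z\<close>.\<close>
  have rt: "feedback_r_tilde k1 k2 k3 k4 (f t) = k4 * e1 + F2
        + k1 * k2 * B / N * (cos (\<theta> t) * sin (\<gamma> t) - d * (s * Z))
        - k1 * r\<^sup>2 * c * N * (S2 + e2 * S2 * T2 * B)
        + k1 * d * S1 * N / c * (1 + e2 * T2 * B)
        + k1 * (s / c) * N / c\<^sup>2 * s * (S2 + e2 * S2 * T2 * B)"
  proof -
    have "sin (2 * \<zeta> t) / 2 = s * c"
      by (simp add: sin_double s_def c_def)
    then have "cos (\<theta> t) * s\<^sup>2 * cos (\<gamma> t) + sin (\<theta> t) * sin (2 * \<zeta> t) / 2 = s * Z"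
      by (simp add: Z_def algebra_simps power2_eq_square flip: times_divide_eq_right)
    then show ?thesis
      by (simp add: feedback_r_tilde_def ft Let_def F2 S1_def S2_def T2_def r_def d_def
        flip: N_def[unfolded ft] B_def[unfolded ft] e1_def[unfolded ft] e2_def[unfolded ft] c_def s_def tan)
  qed
  have q: "feedback_q k1 k2 k3 k5 (f t) = - k5 * e2 + k1 * k2 * d\<^sup>2 * T2 * B
        + k1 / (N\<^sup>2 * B) * (k2\<^sup>2 * d * cos (\<theta> t) * c * sin (\<gamma> t) * (k3 * s + s / c) - Z * C)
        - k1 * r\<^sup>2 * B * (s * T1 * N - c * T2)
        - k1 * (s / c) * B / c\<^sup>2 * (s * T2 + c * T1 * N)"
    unfolding feedback_q_def ft case_prod_conv Let_def
    unfolding N_def[symmetric, unfolded ft] B_def[symmetric, unfolded ft]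
      e2_def[symmetric, unfolded ft]
    by (simp add: Z_def C_def aux_C_def T1_def T2_def tan r_def d_def flip: c_def s_def)
  have d4t: "((\<lambda>t. tan (\<zeta> t)) has_real_derivative \<mu> * (F4 / c\<^sup>2)) (at t within S)"
    using c by (auto intro!: derivative_eq_intros d4 simp: c_def divide_inverse)
  define E1 where "E1 = F3 + (k2 * F2 * c - k2 * d * s * F4) / N\<^sup>2"
  have de1: "((\<lambda>t. aux_e1 k2 (f t)) has_real_derivative \<mu> * E1) (at t within S)"
  proof -
    have "((\<lambda>t. aux_e1 k2 (f t)) has_real_derivative
       \<mu> * F3 + (k2 * (\<mu> * F2) * c + k2 * d * (- s * (\<mu> * F4))) / N\<^sup>2) (at t within S)"
      unfolding aux_e1_def ft case_prod_conv N(2)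
      by (auto intro!: derivative_eq_intros d2 d3 d4
        simp: c_def s_def d_def divide_inverse power_mult_distrib algebra_simps)
    then show ?thesis by (simp add: E1_def add_divide_distrib diff_divide_distrib algebra_simps)
  qed
  have dN: "((\<lambda>t. aux_N k2 (f t)) has_real_derivative
      \<mu> * (k2\<^sup>2 * (d * F2 * c\<^sup>2 - d\<^sup>2 * c * s * F4) / N)) (at t within S)"
  proof -
    have sq: "((\<lambda>t. 1 + k2\<^sup>2 * (\<delta> t)\<^sup>2 * (cos (\<zeta> t))\<^sup>2) has_real_derivative
       2 * \<mu> * (k2\<^sup>2 * (d * F2 * c\<^sup>2 - d\<^sup>2 * c * s * F4))) (at t within S)"
      by (auto intro!: derivative_eq_intros d2 d4 simp: c_def s_def d_def algebra_simps power2_eq_square)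
    have "(sqrt has_real_derivative inverse N / 2) (at (1 + k2\<^sup>2 * (\<delta> t)\<^sup>2 * (cos (\<zeta> t))\<^sup>2))"
      using DERIV_real_sqrt[of "1 + k2\<^sup>2 * (\<delta> t)\<^sup>2 * (cos (\<zeta> t))\<^sup>2"] N(3)
      by (simp add: c_def d_def add_pos_nonneg)
    from DERIV_chain2[OF this sq]
    have "((\<lambda>t. sqrt (1 + k2\<^sup>2 * (\<delta> t)\<^sup>2 * (cos (\<zeta> t))\<^sup>2)) has_real_derivative
       inverse N / 2 * (2 * \<mu> * (k2\<^sup>2 * (d * F2 * c\<^sup>2 - d\<^sup>2 * c * s * F4)))) (at t within S)" .
    moreover have "inverse N / 2 * (2 * \<mu> * X) = \<mu> * (X / N)" for X
      by (simp add: field_simps)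
    ultimately show ?thesis
      unfolding aux_N_def ft case_prod_conv by metis
  qed
  define E2 where "E2 = F5 + ((k3 * c + 1 / c\<^sup>2) * F4 * N
        - (k3 * s + s / c) * (k2\<^sup>2 * (d * F2 * c\<^sup>2 - d\<^sup>2 * c * s * F4) / N)) / N\<^sup>2 / B\<^sup>2"
  have de2: "((\<lambda>t. aux_e2 k2 k3 (f t)) has_real_derivative \<mu> * E2) (at t within S)"
  proof -
    have eta: "aux_eta k2 k3 (f u) = (k3 * sin (\<zeta> u) + tan (\<zeta> u)) / aux_N k2 (f u)" for u
      by (simp add: aux_eta_def aux_N_def ft)
    have "((\<lambda>t. k3 * sin (\<zeta> t) + tan (\<zeta> t)) has_real_derivative
        k3 * (c * (\<mu> * F4)) + \<mu> * (F4 / c\<^sup>2)) (at t within S)"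
      by (intro DERIV_add d4t) (auto intro!: derivative_eq_intros d4 simp: c_def)
    also have "k3 * (c * (\<mu> * F4)) + \<mu> * (F4 / c\<^sup>2) = \<mu> * ((k3 * c + 1 / c\<^sup>2) * F4)"
      by (simp add: algebra_simps)
    finally have "((\<lambda>t. k3 * sin (\<zeta> t) + tan (\<zeta> t)) has_real_derivative
        \<mu> * ((k3 * c + 1 / c\<^sup>2) * F4)) (at t within S)" .
    from DERIV_divide[OF this dN]
    have "((\<lambda>t. aux_eta k2 k3 (f t)) has_real_derivative
       (\<mu> * ((k3 * c + 1 / c\<^sup>2) * F4) * N - (k3 * s + s / c)
         * (\<mu> * (k2\<^sup>2 * (d * F2 * c\<^sup>2 - d\<^sup>2 * c * s * F4) / N))) / (N * N)) (at t within S)"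
      using N(1) unfolding eta by (simp add: tan s_def N_def)
    then have "((\<lambda>t. \<theta> t + arctan (aux_eta k2 k3 (f t))) has_real_derivative
       \<mu> * F5 + inverse (1 + \<eta>\<^sup>2) * ((\<mu> * ((k3 * c + 1 / c\<^sup>2) * F4) * N - (k3 * s + s / c)
         * (\<mu> * (k2\<^sup>2 * (d * F2 * c\<^sup>2 - d\<^sup>2 * c * s * F4) / N))) / (N * N))) (at t within S)"
      unfolding \<eta>_def by (intro DERIV_add d5 DERIV_chain2[OF DERIV_arctan])
    moreover have "aux_e2 k2 k3 (f u) = \<theta> u + arctan (aux_eta k2 k3 (f u))" for u
      by (simp add: aux_e2_def ft)
    moreover have "\<mu> * E2 = \<mu> * F5 + inverse (1 + \<eta>\<^sup>2) * ((\<mu> * ((k3 * c + 1 / c\<^sup>2) * F4) * N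
      - (k3 * s + s / c) * (\<mu> * (k2\<^sup>2 * (d * F2 * c\<^sup>2 - d\<^sup>2 * c * s * F4) / N))) / (N * N))"
      unfolding E2_def B(2)
      by (simp add: divide_inverse power2_eq_square algebra_simps)
    ultimately show ?thesis by simp
  qed
  have sq: "((\<lambda>t. (g t)\<^sup>2) has_real_derivative 2 * (g t * D)) (at t within S)"
    if "(g has_real_derivative D) (at t within S)" for g D
    using that by (auto intro!: derivative_eq_intros)
  have "lyap (f u) = (\<rho> u)\<^sup>2 + (\<delta> u)\<^sup>2 + (tan (\<zeta> u))\<^sup>2 + (aux_e1 k2 (f u))\<^sup>2 + (aux_e2 k2 k3 (f u))\<^sup>2" for u
    by (simp add: lyap_def defs)
  then have "((\<lambda>t. lyap (f t)) has_real_derivative 2 * (r * (\<mu> * F1)) + 2 * (d * (\<mu> * F2))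
      + 2 * ((s / c) * (\<mu> * (F4 / c\<^sup>2))) + 2 * (e1 * (\<mu> * E1)) + 2 * (e2 * (\<mu> * E2))) (at t within S)"
    unfolding r_def d_def tan[symmetric] e1_def e2_def
    by (simp only:) (intro DERIV_add sq d1 d2 d4t de1 de2)
  moreover have "2 * (r * (\<mu> * F1)) + 2 * (d * (\<mu> * F2))
      + 2 * ((s / c) * (\<mu> * (F4 / c\<^sup>2))) + 2 * (e1 * (\<mu> * E1)) + 2 * (e2 * (\<mu> * E2))
      = 2 * \<mu> * (r * F1 + d * F2 + (s / c) * (F4 / c\<^sup>2) + e1 * E1 + e2 * E2)"
    by (simp add: algebra_simps)
  moreover have "r * F1 + d * F2 + (s / c) * (F4 / c\<^sup>2) + e1 * E1 + e2 * E2 = - dissipation (f t)"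
  proof -
    have E1: "E1 = - k4 * e1 + k1 * r\<^sup>2 * c * N * (S2 + e2 * S2 * T2 * B)
        - k1 * d * S1 * N / c * (1 + e2 * T2 * B)
        - k1 * (s / c) * N / c\<^sup>2 * s * (S2 + e2 * S2 * T2 * B)"
    proof -
      \<comment> \<open>The derivative of \<open>arctan (k2 \<delta> cos \<zeta>)\<close> coincides
        with the summand of the yaw feedback that offsets it.\<close>
      have "(k2 * F2 * c - k2 * d * s * F4) / N\<^sup>2 =
          k1 * k2 * B / N * (cos (\<theta> t) * sin (\<gamma> t) - d * (s * Z))"
        using N(1) c unfolding F2 F4 by (simp add: field_simps power2_eq_square)
      then show ?thesis unfolding E1_def F3 rt by simp
    qed
    have E2: "E2 = - k5 * e2 + k1 * k2 * d\<^sup>2 * T2 * B - k1 * r\<^sup>2 * B * (s * T1 * N - c * T2)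
        - k1 * (s / c) * B / c\<^sup>2 * (s * T2 + c * T1 * N)"
      using decay_e2[OF c N(1) B(1) sc N(2) C_def, of k1 Z "cos (\<theta> t)" "sin (\<gamma> t)"]
      unfolding E2_def F5 q F2 F4 by simp
    have 1: "r * F1 = - k1 * r\<^sup>2 * (k3 * s\<^sup>2 + 1 / c)
        + e2 * (k1 * r\<^sup>2 * B * (s * T1 * N - c * T2))
        - e1 * (k1 * r\<^sup>2 * c * N * (S2 + e2 * S2 * T2 * B))"
      unfolding F1 by (rule decay_rho[OF c N(1) B(1) sc \<eta> ct sth cg])
    have 2: "d * F2 = - k1 * k2 * d\<^sup>2 - e2 * (k1 * k2 * d\<^sup>2 * T2 * B)
        + e1 * (k1 * d * S1 * N / c * (1 + e2 * T2 * B))"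
      unfolding F2 by (rule decay_delta[OF c N(1) B(1) ct sg])
    have 3: "s / c * (F4 / c\<^sup>2) = - k1 * k3 * (s / c)\<^sup>2
        + e2 * (k1 * (s / c) * B / c\<^sup>2 * (s * T2 + c * T1 * N))
        + e1 * (k1 * (s / c) * N / c\<^sup>2 * s * (S2 + e2 * S2 * T2 * B))"
      unfolding F4 Z_def by (rule decay_zeta[OF c N(1) B(1) \<eta> ct sth cg])
    have 4: "dissipation (f t) = k1 * r\<^sup>2 * (k3 * s\<^sup>2 + 1 / c) + k1 * k2 * d\<^sup>2
        + k1 * k3 * (s / c)\<^sup>2 + k4 * e1\<^sup>2 + k5 * e2\<^sup>2"
      unfolding dissipation_def e1_def e2_def
      by (simp add: ft tan r_def d_def c_def s_def)
    \<comment> \<open>The \<open>A\<close>s are the dissipative parts of \<open>\<rho>\<close>,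
      \<open>\<delta>\<close>, \<open>\<zeta>\<close>; the \<open>x\<close>s and \<open>y\<close>s
      are the coefficients of \<open>e2\<close> and \<open>e1\<close>, which reappear in
      \<open>E2\<close> and \<open>E1\<close> with opposite sign.\<close>
    have cancel: "(A1 + e2 * x1 - e1 * y1) + (A2 - e2 * x2 + e1 * y2) + (A3 + e2 * x3 + e1 * y3)
        + e1 * (- k4 * e1 + y1 - y2 - y3) + e2 * (- k5 * e2 + x2 - x1 - x3)
        = A1 + A2 + A3 - k4 * e1\<^sup>2 - k5 * e2\<^sup>2" for A1 A2 A3 x1 x2 x3 y1 y2 y3
      by (simp add: algebra_simps power2_eq_square)
    show ?thesis
      unfolding 1 2 3 4 E1 E2 cancel by simp
  qed
  ultimately show ?thesis by simp
qed

subsection \<open>Exponential decay\<close>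

definition rate :: real where
  "rate = Min {k1, k1 * k2, k1 * k3, k4, k5}"

lemma rate: "rate > 0" "rate \<le> k1" "rate \<le> k1 * k2" "rate \<le> k1 * k3" "rate \<le> k4" "rate \<le> k5"
  using gains_pos by (auto simp: rate_def)

text \<open>Only the \<open>\<rho>\<close> term needs an argument:
  \<open>1 / cos \<zeta> \<ge> 1\<close>, so its coefficient is at least \<open>k1\<close>.\<close>

lemma dissipation_ge:
  assumes "s \<in> state_space"
  shows "rate * lyap s \<le> dissipation s"
proof -
  obtain \<rho> \<delta> \<gamma> \<zeta> \<theta> where s: "s = (\<rho>, \<delta>, \<gamma>, \<zeta>, \<theta>)" by (cases s) auto
  have c: "cos \<zeta> > 0"
    using assms by (auto simp: s state_space_def intro!: cos_gt_zero_pi)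
  have "1 \<le> 1 / cos \<zeta>" "0 \<le> k3 * (sin \<zeta>)\<^sup>2"
    using c gains_pos by simp_all
  then have "1 \<le> k3 * (sin \<zeta>)\<^sup>2 + 1 / cos \<zeta>"
    by linarith
  then have "k1 * \<rho>\<^sup>2 * 1 \<le> k1 * \<rho>\<^sup>2 * (k3 * (sin \<zeta>)\<^sup>2 + 1 / cos \<zeta>)"
    using gains_pos by (intro mult_left_mono) auto
  moreover have "rate * \<rho>\<^sup>2 \<le> k1 * \<rho>\<^sup>2" by (intro mult_right_mono rate) auto
  moreover have "rate * \<delta>\<^sup>2 \<le> k1 * k2 * \<delta>\<^sup>2" by (intro mult_right_mono rate) auto
  moreover have "rate * (tan \<zeta>)\<^sup>2 \<le> k1 * k3 * (tan \<zeta>)\<^sup>2" by (intro mult_right_mono rate) auto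
  moreover have "rate * (aux_e1 k2 s)\<^sup>2 \<le> k4 * (aux_e1 k2 s)\<^sup>2" by (intro mult_right_mono rate) auto
  moreover have "rate * (aux_e2 k2 k3 s)\<^sup>2 \<le> k5 * (aux_e2 k2 k3 s)\<^sup>2" by (intro mult_right_mono rate) auto
  ultimately show ?thesis
    unfolding lyap_def dissipation_def s by (simp add: algebra_simps)
qed

lemma lyap_nonneg: "lyap s \<ge> 0"
  by (simp add: lyap_def)

text \<open>Exchanging \<open>\<gamma>\<close>, \<open>\<theta>\<close> for \<open>e1\<close>,
  \<open>e2\<close> adds at most \<open>k2\<close> to the weight of
  \<open>\<bar>\<delta>\<bar>\<close> and \<open>k3 + 1\<close> to that of
  \<open>\<bar>tan \<zeta>\<bar>\<close>; \<open>2 + k2 + k3\<close> dominates both resulting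
  weights.\<close>

definition gain :: real where
  "gain = 2 + k2 + k3"

lemma abs_feedback_angles:
  assumes "s = (\<rho>, \<delta>, \<gamma>, \<zeta>, \<theta>)" "\<bar>\<zeta>\<bar> < pi / 2"
  shows "\<bar>aux_e1 k2 s - \<gamma>\<bar> \<le> k2 * \<bar>\<delta>\<bar>" "\<bar>aux_e2 k2 k3 s - \<theta>\<bar> \<le> (k3 + 1) * \<bar>tan \<zeta>\<bar>"
proof -
  have c: "cos \<zeta> > 0" using assms by (auto intro!: cos_gt_zero_pi)
  have "\<bar>aux_e1 k2 s - \<gamma>\<bar> \<le> k2 * \<bar>\<delta>\<bar> * cos \<zeta>"
    using abs_arctan_le[of "k2 * \<delta> * cos \<zeta>"] c gains_pos
    by (simp add: assms aux_e1_def abs_mult)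
  also have "\<dots> \<le> k2 * \<bar>\<delta>\<bar> * 1"
    using gains_pos by (intro mult_left_mono) auto
  finally show "\<bar>aux_e1 k2 s - \<gamma>\<bar> \<le> k2 * \<bar>\<delta>\<bar>" by simp
  have st: "\<bar>sin \<zeta>\<bar> \<le> \<bar>tan \<zeta>\<bar>"
  proof -
    have "\<bar>sin \<zeta>\<bar> = \<bar>tan \<zeta>\<bar> * cos \<zeta>" using c by (simp add: tan_def abs_mult)
    also have "\<dots> \<le> \<bar>tan \<zeta>\<bar> * 1" by (intro mult_left_mono) auto
    finally show ?thesis by simp
  qed
  define N where "N = sqrt (1 + k2\<^sup>2 * \<delta>\<^sup>2 * (cos \<zeta>)\<^sup>2)"
  have N: "N \<ge> 1" by (simp add: N_def)
  have "\<bar>aux_e2 k2 k3 s - \<theta>\<bar> \<le> \<bar>(k3 * sin \<zeta> + tan \<zeta>) / N\<bar>"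
    using abs_arctan_le[of "(k3 * sin \<zeta> + tan \<zeta>) / N"]
    by (simp only: assms aux_e2_def aux_eta_def N_def case_prod_conv add_diff_cancel_left')
  also have "\<dots> \<le> \<bar>k3 * sin \<zeta> + tan \<zeta>\<bar> / 1"
    unfolding abs_divide using N by (intro divide_left_mono) auto
  also have "\<dots> \<le> k3 * \<bar>sin \<zeta>\<bar> + \<bar>tan \<zeta>\<bar>"
    using gains_pos abs_triangle_ineq[of "k3 * sin \<zeta>" "tan \<zeta>"] by (simp add: abs_mult)
  also have "\<dots> \<le> k3 * \<bar>tan \<zeta>\<bar> + \<bar>tan \<zeta>\<bar>"
    using st gains_pos by (intro add_mono mult_left_mono) auto
  finally show "\<bar>aux_e2 k2 k3 s - \<theta>\<bar> \<le> (k3 + 1) * \<bar>tan \<zeta>\<bar>" by (simp add: algebra_simps)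
qed

lemma norm_D_equiv_lyap:
  assumes "s \<in> state_space"
  shows "norm_D s \<le> 3 * gain * sqrt (lyap s)" and "sqrt (lyap s) \<le> gain * norm_D s"
proof -
  obtain \<rho> \<delta> \<gamma> \<zeta> \<theta> where s: "s = (\<rho>, \<delta>, \<gamma>, \<zeta>, \<theta>)" by (cases s) auto
  have \<rho>: "\<rho> > 0" and z: "\<bar>\<zeta>\<bar> < pi / 2" using assms by (auto simp: s state_space_def)
  define e1 e2 w where "e1 = aux_e1 k2 s" and "e2 = aux_e2 k2 k3 s" and "w = tan \<zeta>"
  note ang = abs_feedback_angles[OF s z, folded e1_def e2_def w_def]
  have V: "lyap s = \<rho>\<^sup>2 + \<delta>\<^sup>2 + w\<^sup>2 + e1\<^sup>2 + e2\<^sup>2"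
    by (simp add: lyap_def s e1_def e2_def w_def)
  have D: "norm_D s = \<rho> + \<bar>\<delta>\<bar> + \<bar>\<gamma>\<bar> + \<bar>w\<bar> + \<bar>\<theta>\<bar>"
    by (simp add: norm_D_def s w_def)
  define T where "T = \<rho> + \<bar>\<delta>\<bar> + \<bar>w\<bar> + \<bar>e1\<bar> + \<bar>e2\<bar>"
  have T0: "T \<ge> 0" using \<rho> by (simp add: T_def)
  \<comment> \<open>The relation between the two pairs of angles is symmetric, so this inequality is
    used once in each direction.\<close>
  have sum_le: "\<rho> + d + w + g + h \<le> gain * (\<rho> + d + w + e + f)"
    if "g \<le> e + k2 * d" "h \<le> f + (k3 + 1) * w" "d \<ge> 0" "w \<ge> 0" "e \<ge> 0" "f \<ge> 0" for d w g h e f :: real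
  proof -
    have "k2 * d \<le> k2 * (\<rho> + d + w + e + f)" "k3 * w \<le> k3 * (\<rho> + d + w + e + f)"
      using that \<rho> gains_pos by (intro mult_left_mono; simp)+
    then show ?thesis
      using that \<rho> unfolding gain_def distrib_right[of _ _ "\<rho> + d + w + e + f"] by (simp add: distrib_right)
  qed
  have "\<bar>\<gamma>\<bar> \<le> \<bar>e1\<bar> + k2 * \<bar>\<delta>\<bar>" "\<bar>e1\<bar> \<le> \<bar>\<gamma>\<bar> + k2 * \<bar>\<delta>\<bar>"
      "\<bar>\<theta>\<bar> \<le> \<bar>e2\<bar> + (k3 + 1) * \<bar>w\<bar>" "\<bar>e2\<bar> \<le> \<bar>\<theta>\<bar> + (k3 + 1) * \<bar>w\<bar>"
    using ang by linarith+
  then have DT: "norm_D s \<le> gain * T" and TD: "T \<le> gain * norm_D s"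
    using sum_le[of "\<bar>\<gamma>\<bar>" "\<bar>e1\<bar>" "\<bar>\<delta>\<bar>" "\<bar>\<theta>\<bar>" "\<bar>e2\<bar>" "\<bar>w\<bar>"]
      sum_le[of "\<bar>e1\<bar>" "\<bar>\<gamma>\<bar>" "\<bar>\<delta>\<bar>" "\<bar>e2\<bar>" "\<bar>\<theta>\<bar>" "\<bar>w\<bar>"]
    by (simp_all only: D T_def abs_ge_zero ac_simps)
  have "T\<^sup>2 \<le> 5 * lyap s"
  proof -
    have "(a + b + c + d + e)\<^sup>2 \<le> 5 * (a\<^sup>2 + b\<^sup>2 + c\<^sup>2 + d\<^sup>2 + e\<^sup>2)" for a b c d e :: real
    proof -
      have "5 * (a\<^sup>2 + b\<^sup>2 + c\<^sup>2 + d\<^sup>2 + e\<^sup>2) - (a + b + c + d + e)\<^sup>2 =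
        (a - b)\<^sup>2 + (a - c)\<^sup>2 + (a - d)\<^sup>2 + (a - e)\<^sup>2 + (b - c)\<^sup>2 + (b - d)\<^sup>2 + (b - e)\<^sup>2
        + (c - d)\<^sup>2 + (c - e)\<^sup>2 + (d - e)\<^sup>2"
        by (simp add: power2_eq_square algebra_simps)
      also have "\<dots> \<ge> 0" by simp
      finally show ?thesis by simp
    qed
    from this[of \<rho> "\<bar>\<delta>\<bar>" "\<bar>w\<bar>" "\<bar>e1\<bar>" "\<bar>e2\<bar>"] show ?thesis
      by (simp only: T_def V power2_abs)
  qed
  \<comment> \<open>The factor 3 of the norm comparison is \<open>sqrt 5\<close> rounded up.\<close>
  also have "5 * lyap s \<le> (3 * sqrt (lyap s))\<^sup>2"
    using lyap_nonneg[of s] by (simp add: power_mult_distrib)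
  finally have "T \<le> 3 * sqrt (lyap s)"
    by (rule power2_le_imp_le) (use lyap_nonneg[of s] in simp)
  then have "gain * T \<le> gain * (3 * sqrt (lyap s))"
    using gains_pos by (intro mult_left_mono) (auto simp: gain_def)
  with DT show "norm_D s \<le> 3 * gain * sqrt (lyap s)" by simp
  have "lyap s \<le> T\<^sup>2"
  proof -
    have "a\<^sup>2 + b\<^sup>2 + c\<^sup>2 + d\<^sup>2 + e\<^sup>2 \<le> (a + b + c + d + e)\<^sup>2"
      if "a \<ge> 0" "b \<ge> 0" "c \<ge> 0" "d \<ge> 0" "e \<ge> 0" for a b c d e :: real
      using that by (simp add: power2_eq_square algebra_simps)
    from this[of \<rho> "\<bar>\<delta>\<bar>" "\<bar>w\<bar>" "\<bar>e1\<bar>" "\<bar>e2\<bar>"] show ?thesis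
      using less_imp_le[OF \<rho>] by (simp only: T_def V power2_abs abs_ge_zero)
  qed
  then have "sqrt (lyap s) \<le> T" using T0 by (simp add: real_le_lsqrt)
  then show "sqrt (lyap s) \<le> gain * norm_D s" using TD by simp
qed

text \<open>\<open>lyap\<close> times \<open>exp (2 * rate * t)\<close> does not increase; taking
  roots halves the exponent. The constant is the product \<open>3 * gain\<close> times
  \<open>gain\<close> of the two norm comparisons. The interval is arbitrary, so solutions that
  might stop early are covered.\<close>

lemma norm_D_decay:
  assumes J: "forward_interval t0 J" and sol: "spherical_solution k1 k2 k3 k4 k5 J \<Theta>" and t: "t \<in> J"
  shows "norm_D (\<Theta> t) \<le> 3 * gain\<^sup>2 * norm_D (\<Theta> t0) * exp (- rate * (t - t0))"
proof -
  have t0: "t0 \<in> J" "t0 \<le> t" and sub: "{t0..t} \<subseteq> J"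
    using J t unfolding forward_interval_def is_interval_1 by auto
  have S: "\<Theta> s \<in> state_space" if "s \<in> J" for s
    using sol that by (auto simp: spherical_solution_def)
  have "lyap (\<Theta> t) * exp (2 * rate * t) \<le> lyap (\<Theta> t0) * exp (2 * rate * t0)"
  proof (rule antimono_from_derivative_within[OF t0(2), of "\<lambda>s. lyap (\<Theta> s) * exp (2 * rate * s)"])
    fix s assume s: "s \<in> {t0..t}"
    then have sJ: "s \<in> J" using sub by auto
    have "(\<Theta> has_vector_derivative 1 *\<^sub>R spherical_field k1 k2 k3 k4 k5 (\<Theta> s)) (at s within {t0..t})"
      using sol sJ by (auto simp: spherical_solution_def intro: has_vector_derivative_within_subset[OF _ sub])
    from lyap_deriv[OF this S[OF sJ]]
    show "((\<lambda>s. lyap (\<Theta> s) * exp (2 * rate * s)) has_real_derivative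
        - (2 * exp (2 * rate * s) * (dissipation (\<Theta> s) - rate * lyap (\<Theta> s)))) (at s within {t0..t})"
      by (auto intro!: derivative_eq_intros simp: algebra_simps)
    show "- (2 * exp (2 * rate * s) * (dissipation (\<Theta> s) - rate * lyap (\<Theta> s))) \<le> 0"
      using dissipation_ge[OF S[OF sJ]] by auto
  qed
  then have "lyap (\<Theta> t) \<le> lyap (\<Theta> t0) * (exp (2 * rate * t0) / exp (2 * rate * t))"
    by (simp add: field_simps)
  also have "exp (2 * rate * t0) / exp (2 * rate * t) = (exp (- rate * (t - t0)))\<^sup>2"
    by (simp add: power2_eq_square algebra_simps flip: exp_add exp_diff)
  finally have "sqrt (lyap (\<Theta> t)) \<le> sqrt (lyap (\<Theta> t0)) * exp (- rate * (t - t0))"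
    using real_sqrt_le_mono by (fastforce simp: real_sqrt_mult)
  also have "\<dots> \<le> gain * norm_D (\<Theta> t0) * exp (- rate * (t - t0))"
    by (intro mult_right_mono norm_D_equiv_lyap S t0) auto
  finally have "3 * gain * sqrt (lyap (\<Theta> t)) \<le> 3 * gain * (gain * norm_D (\<Theta> t0) * exp (- rate * (t - t0)))"
    using gains_pos by (intro mult_left_mono) (auto simp: gain_def)
  then show ?thesis
    using norm_D_equiv_lyap(1)[OF S[OF t]] by (simp add: power2_eq_square algebra_simps)
qed

end

subsection \<open>Existence of closed-loop solutions\<close>

text \<open>From \<open>2 * \<bar>x\<bar> \<le> x\<^sup>2 + 1\<close>; a bound affine in
  \<open>a\<close> keeps square roots out of the radii below.\<close>

lemma abs_le_of_square_le: "\<bar>x\<bar> \<le> a + 1" if "x\<^sup>2 \<le> a" for x a :: real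
proof -
  have "(\<bar>x\<bar> - 1)\<^sup>2 \<ge> 0" by simp
  then show ?thesis using that by (simp add: power2_eq_square algebra_simps flip: abs_mult)
qed

lemma norm_tuple5_le:
  fixes a :: "'a::real_normed_vector" and b :: "'b::real_normed_vector" and c :: "'c::real_normed_vector"
    and d :: "'d::real_normed_vector" and e :: "'e::real_normed_vector"
  shows "norm (a, b, c, d, e) \<le> norm a + (norm b + (norm c + (norm d + norm e)))"
  using norm_Pair_le[of a "(b, c, d, e)"] norm_Pair_le[of b "(c, d, e)"]
    norm_Pair_le[of c "(d, e)"] norm_Pair_le[of d e]
  by linarith

lemma one_plus_squares_nz [simp]: "1 + a\<^sup>2 * b\<^sup>2 * c\<^sup>2 \<noteq> 0" for a b c :: real
  using zero_le_mult_iff[of "a\<^sup>2 * b\<^sup>2" "c\<^sup>2"] by (smt (verit) zero_le_mult_iff zero_le_power2)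

section \<open>The closed loop with tan zeta as coordinate\<close>

context gains
begin

text \<open>In this chart the state space becomes the half space where the first coordinate is
  positive. As \<open>cos (arctan w)\<close> never vanishes, the feedback formulas make sense and
  are Lipschitz on bounded subsets of the whole space.\<close>

definition of_tan :: "state \<Rightarrow> state" where
  "of_tan y = (fst y, fst (snd y), fst (snd (snd y)), arctan (fst (snd (snd (snd y)))),
     snd (snd (snd (snd y))))"

lemma lipschitz_on_bounded_aux_N: "lipschitz_on_bounded (\<lambda>y. aux_N k2 (of_tan y))"
  unfolding aux_N_def of_tan_def case_prod_conv
  by (intro lipschitz_on_bounded_intros) auto

lemma lipschitz_on_bounded_aux_eta: "lipschitz_on_bounded (\<lambda>y. aux_eta k2 k3 (of_tan y))"
  unfolding aux_eta_def of_tan_def case_prod_conv tan_arctan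
  by (intro lipschitz_on_bounded_intros) auto

lemma lipschitz_on_bounded_aux_e1: "lipschitz_on_bounded (\<lambda>y. aux_e1 k2 (of_tan y))"
  unfolding aux_e1_def of_tan_def case_prod_conv
  by (intro lipschitz_on_bounded_intros)

lemma lipschitz_on_bounded_aux_e2: "lipschitz_on_bounded (\<lambda>y. aux_e2 k2 k3 (of_tan y))"
  using lipschitz_on_bounded_aux_eta unfolding aux_e2_def of_tan_def case_prod_conv
  by (intro lipschitz_on_bounded_intros)

lemma lipschitz_on_bounded_aux_B: "lipschitz_on_bounded (\<lambda>y. aux_B k2 k3 (of_tan y))"
  unfolding aux_B_def by (intro lipschitz_on_bounded_intros lipschitz_on_bounded_aux_eta) auto

lemma lipschitz_on_bounded_aux_C: "lipschitz_on_bounded (\<lambda>y. aux_C k2 k3 (of_tan y))"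
  unfolding aux_C_def of_tan_def case_prod_conv tan_arctan
  by (intro lipschitz_on_bounded_intros)

lemma aux_nz: "aux_N k2 s \<noteq> 0" "aux_B k2 k3 s \<noteq> 0"
proof -
  show "aux_N k2 s \<noteq> 0" by (cases s) (simp add: aux_N_def)
  have "1 + (aux_eta k2 k3 s)\<^sup>2 > 0" by (simp add: add_pos_nonneg)
  then show "aux_B k2 k3 s \<noteq> 0" by (simp add: aux_B_def)
qed

lemma lipschitz_on_bounded_feedback_q: "lipschitz_on_bounded (\<lambda>y. feedback_q k1 k2 k3 k5 (of_tan y))"
  using lipschitz_on_bounded_aux_N lipschitz_on_bounded_aux_B lipschitz_on_bounded_aux_C lipschitz_on_bounded_aux_e2 aux_nz
  unfolding feedback_q_def of_tan_def case_prod_conv tan_arctan Let_def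
  by (intro lipschitz_on_bounded_intros) auto

lemma lipschitz_on_bounded_feedback_r_tilde: "lipschitz_on_bounded (\<lambda>y. feedback_r_tilde k1 k2 k3 k4 (of_tan y))"
  using lipschitz_on_bounded_aux_N lipschitz_on_bounded_aux_B lipschitz_on_bounded_aux_e1 lipschitz_on_bounded_aux_e2 aux_nz
  unfolding feedback_r_tilde_def of_tan_def case_prod_conv tan_arctan Let_def
  by (intro lipschitz_on_bounded_intros) auto

lemma lipschitz_on_bounded_lyap: "lipschitz_on_bounded (\<lambda>y. lyap (of_tan y))"
  unfolding lyap_def
  by (intro lipschitz_on_bounded_intros lipschitz_on_bounded_aux_e1 lipschitz_on_bounded_aux_e2) (simp_all add: of_tan_def tan_arctan lipschitz_on_bounded_intros)

text \<open>The logarithmic derivative of \<open>\<rho>\<close>; it turns the first equation into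
  the linear form that preserves positivity.\<close>

definition rho_rate :: "state \<Rightarrow> real" where
  "rho_rate = (\<lambda>(\<rho>, \<delta>, \<gamma>, \<zeta>, \<theta>). k1 * aux_N k2 (\<rho>, \<delta>, \<gamma>, \<zeta>, \<theta>) * aux_B k2 k3 (\<rho>, \<delta>, \<gamma>, \<zeta>, \<theta>)
     * (sin \<theta> * sin \<zeta> - cos \<theta> * cos \<zeta> * cos \<gamma>))"

text \<open>The closed loop in the coordinates \<open>(\<rho>, \<delta>, \<gamma>, tan \<zeta>, \<theta>)\<close>: here the factor \<open>\<rho>\<close> of \<open>v\<close> is
  cancelled against the division by \<open>\<rho>\<close>, so that the field is defined on all of the space.\<close>

definition field_tan :: "state \<Rightarrow> state" where
  "field_tan y = (case of_tan y of (\<rho>, \<delta>, \<gamma>, \<zeta>, \<theta>) \<Rightarrow>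
     let M = k1 * aux_N k2 (of_tan y) * aux_B k2 k3 (of_tan y)
     in (\<rho> * rho_rate (of_tan y),
         M * cos \<theta> / cos \<zeta> * sin \<gamma>,
         M * cos \<theta> / cos \<zeta> * sin \<gamma> - feedback_r_tilde k1 k2 k3 k4 (of_tan y),
         M * (cos \<theta> * sin \<zeta> * cos \<gamma> + sin \<theta> * cos \<zeta>) / (cos \<zeta>)\<^sup>2,
         feedback_q k1 k2 k3 k5 (of_tan y)))"

lemma lipschitz_on_bounded_rho_rate: "lipschitz_on_bounded (\<lambda>y. rho_rate (of_tan y))"
  using lipschitz_on_bounded_aux_N lipschitz_on_bounded_aux_B unfolding rho_rate_def of_tan_def case_prod_conv
  by (intro lipschitz_on_bounded_intros)

lemma lipschitz_on_bounded_field_tan: "lipschitz_on_bounded field_tan"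
proof -
  have "lipschitz_on_bounded (\<lambda>y. field_tan y)"
    using lipschitz_on_bounded_aux_N lipschitz_on_bounded_aux_B lipschitz_on_bounded_feedback_q lipschitz_on_bounded_feedback_r_tilde lipschitz_on_bounded_rho_rate
    unfolding field_tan_def of_tan_def case_prod_conv Let_def
    by (intro lipschitz_on_bounded_intros) auto
  then show ?thesis .
qed

text \<open>The factor \<open>1 / cos\<^sup>2 \<zeta>\<close> of the fourth component is undone by
  the derivative of \<open>arctan\<close>. Positivity of \<open>\<rho>\<close> enters because
  \<open>spherical_field\<close> literally divides \<open>v\<close> by
  \<open>\<rho>\<close>.\<close>

lemma of_tan_deriv:
  assumes y: "(y has_vector_derivative \<mu> *\<^sub>R field_tan (y t)) (at t within S)" and pos: "fst (y t) > 0"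
  shows "((\<lambda>t. of_tan (y t)) has_vector_derivative
    \<mu> *\<^sub>R spherical_field k1 k2 k3 k4 k5 (of_tan (y t))) (at t within S)"
proof -
  obtain F1 F2 F3 F4 F5 where F: "field_tan (y t) = (F1, F2, F3, F4, F5)"
    using prod_cases5 by blast
  note fv = y[unfolded F]
  define \<zeta> where "\<zeta> = arctan (fst (snd (snd (snd (y t)))))"
  note D = has_vector_derivative_tuple5D[OF fv[unfolded scaleR_Pair real_scaleR_def]]
  note d4 = D(4)[folded has_real_derivative_iff_has_vector_derivative]
  have cos2: "(cos \<zeta>)\<^sup>2 = inverse (1 + (fst (snd (snd (snd (y t)))))\<^sup>2)"
    by (simp add: \<zeta>_def cos_arctan power_divide inverse_eq_divide)
  have "((\<lambda>t. arctan (fst (snd (snd (snd (y t)))))) has_real_derivative \<mu> * (F4 * (cos \<zeta>)\<^sup>2)) (at t within S)"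
    using DERIV_chain2[OF DERIV_arctan d4] cos2 by (simp add: mult_ac)
  then have d4': "((\<lambda>t. arctan (fst (snd (snd (snd (y t)))))) has_vector_derivative \<mu> * (F4 * (cos \<zeta>)\<^sup>2)) (at t within S)"
    by (simp add: has_real_derivative_iff_has_vector_derivative)
  have "cos \<zeta> \<noteq> 0" by (simp add: \<zeta>_def)
  then have "spherical_field k1 k2 k3 k4 k5 (of_tan (y t)) = (F1, F2, F3, F4 * (cos \<zeta>)\<^sup>2, F5)"
    using F pos
    by (auto simp: field_tan_def of_tan_def spherical_field_def Let_def feedback_v_def rho_rate_def \<zeta>_def[symmetric])
  then show ?thesis
    unfolding of_tan_def
    using has_vector_derivative_Pair[OF D(1) has_vector_derivative_Pair[OF D(2)
      has_vector_derivative_Pair[OF D(3) has_vector_derivative_Pair[OF d4' D(5)]]]]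
    by simp
qed

text \<open>Sublevel sets of the Lyapunov function are bounded in this chart: \<open>e1\<close>,
  \<open>e2\<close> differ from \<open>\<gamma>\<close>, \<open>\<theta>\<close> by values of
  \<open>arctan\<close>, each at most 2 in modulus, whence the final summand 4. No sign of
  \<open>\<rho>\<close> is assumed, as the cutoff must have bounded support in the whole
  space.\<close>

lemma norm_le_of_lyap_le:
  assumes "lyap (of_tan y) \<le> a"
  shows "norm y \<le> 5 * (a + 1) + 4"
proof -
  obtain \<rho> \<delta> \<gamma> w \<theta> where y: "y = (\<rho>, \<delta>, \<gamma>, w, \<theta>)" by (cases y) auto
  define e1 e2 where "e1 = aux_e1 k2 (of_tan y)" and "e2 = aux_e2 k2 k3 (of_tan y)"
  have "\<rho>\<^sup>2 + \<delta>\<^sup>2 + w\<^sup>2 + e1\<^sup>2 + e2\<^sup>2 \<le> a"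
    using assms by (simp add: lyap_def of_tan_def y e1_def e2_def tan_arctan)
  then have "\<rho>\<^sup>2 \<le> a" "\<delta>\<^sup>2 \<le> a" "w\<^sup>2 \<le> a" "e1\<^sup>2 \<le> a" "e2\<^sup>2 \<le> a"
    using zero_le_power2[of \<rho>] zero_le_power2[of \<delta>] zero_le_power2[of w] zero_le_power2[of e1] zero_le_power2[of e2]
    by linarith+
  then have b: "\<bar>\<rho>\<bar> \<le> a + 1" "\<bar>\<delta>\<bar> \<le> a + 1" "\<bar>w\<bar> \<le> a + 1" "\<bar>e1\<bar> \<le> a + 1" "\<bar>e2\<bar> \<le> a + 1"
    by (auto intro: abs_le_of_square_le)
  have at: "\<bar>arctan u\<bar> \<le> 2" for u
    using arctan_bounded[of u] pi_less_4 by auto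
  have "\<bar>e1 - \<gamma>\<bar> \<le> 2" "\<bar>e2 - \<theta>\<bar> \<le> 2"
    using at by (simp_all add: e1_def e2_def aux_e1_def aux_e2_def of_tan_def y)
  then have ang: "\<bar>\<gamma>\<bar> \<le> a + 3" "\<bar>\<theta>\<bar> \<le> a + 3" using b(4,5) by linarith+
  have "norm y \<le> \<bar>\<rho>\<bar> + (\<bar>\<delta>\<bar> + (\<bar>\<gamma>\<bar> + (\<bar>w\<bar> + \<bar>\<theta>\<bar>)))"
    using norm_tuple5_le[of \<rho> \<delta> \<gamma> w \<theta>] by (simp only: y real_norm_def)
  also have "\<dots> \<le> (a + 1) + ((a + 1) + ((a + 3) + ((a + 1) + (a + 3))))"
    by (intro add_mono b ang)
  finally show ?thesis by simp
qed

text \<open>Multiplying the field by a cutoff that depends on the Lyapunov function only makes it globally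
  Lipschitz, keeps that function nonincreasing along solutions, and therefore is never active.\<close>

lemma spherical_solution_exists:
  assumes \<Theta>0: "\<Theta>0 \<in> state_space"
  obtains \<Theta> where "spherical_solution k1 k2 k3 k4 k5 {t0..} \<Theta>" "\<Theta> t0 = \<Theta>0"
proof -
  obtain \<rho>0 \<delta>0 \<gamma>0 \<zeta>0 \<theta>0 where s0: "\<Theta>0 = (\<rho>0, \<delta>0, \<gamma>0, \<zeta>0, \<theta>0)" by (cases \<Theta>0) auto
  define y0 where "y0 = (\<rho>0, \<delta>0, \<gamma>0, tan \<zeta>0, \<theta>0)"
  have \<rho>0: "\<rho>0 > 0" using \<Theta>0 by (auto simp: s0 state_space_def)
  have y0: "of_tan y0 = \<Theta>0"
    using \<Theta>0 by (auto simp: of_tan_def y0_def s0 state_space_def arctan_tan)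
  \<comment> \<open>The cutoff is 1 up to the initial level of \<open>lyap\<close>, 0 from one unit
    above it, and affine in between.\<close>
  define \<mu> where "\<mu> y = max 0 (1 - max 0 (lyap (of_tan y) - lyap \<Theta>0))" for y
  have \<mu>: "\<mu> y \<ge> 0" for y by (simp add: \<mu>_def)
  have lip_\<mu>: "lipschitz_on_bounded \<mu>"
  proof -
    have "lipschitz_on_bounded (\<lambda>y. max 0 (1 - max 0 (lyap (of_tan y) - lyap \<Theta>0)))"
      by (rule lipschitz_on_bounded_real_compose[where g = "\<lambda>v. max 0 (1 - max 0 (v - lyap \<Theta>0))", OF _ lipschitz_on_bounded_lyap]) auto
    then show ?thesis by (simp add: \<mu>_def[abs_def])
  qed
  have supp: "norm y \<le> 5 * (lyap \<Theta>0 + 1 + 1) + 4" if "\<mu> y \<noteq> 0" for y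
    using that by (intro norm_le_of_lyap_le) (auto simp: \<mu>_def max_def split: if_splits)
  have supp_field: "norm y \<le> 5 * (lyap \<Theta>0 + 1 + 1) + 4" if "\<mu> y *\<^sub>R field_tan y \<noteq> 0" for y
    using that by (intro supp) auto
  have supp_rate: "norm y \<le> 5 * (lyap \<Theta>0 + 1 + 1) + 4" if "\<mu> y * rho_rate (of_tan y) \<noteq> 0" for y
    using that by (intro supp) auto
  obtain L M where LM: "L-lipschitz_on UNIV (\<lambda>y. \<mu> y *\<^sub>R field_tan y)"
      "\<forall>y. norm (\<mu> y *\<^sub>R field_tan y) \<le> M"
    using lipschitz_of_bounded_support[OF lipschitz_on_bounded_scaleR[OF lip_\<mu> lipschitz_on_bounded_field_tan] supp_field]
    by auto
  \<comment> \<open>The bound on the damped logarithmic derivative feeds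
    \<open>positive_of_linear_ode\<close>.\<close>
  obtain H where H: "\<forall>y. norm (\<mu> y * rho_rate (of_tan y)) \<le> H"
    using lipschitz_of_bounded_support[OF lipschitz_on_bounded_mult[OF lip_\<mu> lipschitz_on_bounded_rho_rate] supp_rate]
    by auto
  obtain y where y: "y t0 = y0" and
    yd: "\<forall>t\<ge>t0. (y has_vector_derivative \<mu> (y t) *\<^sub>R field_tan (y t)) (at t within {t0..})"
    using global_lipschitz_ivp[OF LM(1) LM(2)[rule_format], of t0 y0] by auto
  note yd = yd[rule_format]
  define \<Theta> where "\<Theta> t = of_tan (y t)" for t
  have pos: "fst (y t) > 0" if "t \<ge> t0" for t
  proof (rule positive_of_linear_ode[where x = "\<lambda>t. fst (y t)" and h = "\<lambda>t. \<mu> (y t) * rho_rate (\<Theta> t)" and H = H])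
    show "((\<lambda>t. fst (y t)) has_real_derivative fst (y t) * (\<mu> (y t) * rho_rate (\<Theta> t))) (at t within {t0..})"
      if "t \<ge> t0" for t
    proof -
      have "fst (\<mu> (y t) *\<^sub>R field_tan (y t)) = fst (y t) * (\<mu> (y t) * rho_rate (\<Theta> t))"
        by (simp add: field_tan_def \<Theta>_def of_tan_def Let_def)
      then show ?thesis
        using bounded_linear.has_vector_derivative[OF bounded_linear_fst yd[OF that]]
        unfolding has_real_derivative_iff_has_vector_derivative by (simp only:)
    qed
    show "\<bar>\<mu> (y t) * rho_rate (\<Theta> t)\<bar> \<le> H" for t
      using H[rule_format, of "y t"] by (simp add: \<Theta>_def)
  qed (use \<rho>0 that y in \<open>simp_all add: y0_def\<close>)
  have "\<bar>arctan u\<bar> < pi / 2" for u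
    using arctan_bounded[of u] by auto
  then have S: "\<Theta> t \<in> state_space" if "t \<ge> t0" for t
    using pos[OF that] by (simp add: state_space_def \<Theta>_def of_tan_def)
  have d\<Theta>: "(\<Theta> has_vector_derivative \<mu> (y t) *\<^sub>R spherical_field k1 k2 k3 k4 k5 (\<Theta> t)) (at t within {t0..})"
    if "t \<ge> t0" for t
    using of_tan_deriv[OF yd[OF that] pos[OF that]] by (simp add: \<Theta>_def[abs_def])
  have "\<mu> (y t) = 1" if t: "t \<ge> t0" for t
  proof -
    \<comment> \<open>Since \<open>\<mu>\<close> is nonnegative, damping cannot change the sign of
      the derivative; the trajectory stays where the cutoff equals 1.\<close>
    have "lyap (\<Theta> t) \<le> lyap (\<Theta> t0)"
    proof (rule antimono_from_derivative_within[OF t])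
      fix s assume s: "s \<in> {t0..t}"
      have "(\<Theta> has_vector_derivative \<mu> (y s) *\<^sub>R spherical_field k1 k2 k3 k4 k5 (\<Theta> s)) (at s within {t0..t})"
        by (rule has_vector_derivative_within_subset[OF d\<Theta>]) (use s in auto)
      then show "((\<lambda>t. lyap (\<Theta> t)) has_real_derivative - (2 * \<mu> (y s) * dissipation (\<Theta> s))) (at s within {t0..t})"
        by (rule lyap_deriv) (use s S in auto)
      have "0 \<le> rate * lyap (\<Theta> s)" using rate lyap_nonneg by simp
      also have "\<dots> \<le> dissipation (\<Theta> s)" by (rule dissipation_ge) (use s S in auto)
      finally show "- (2 * \<mu> (y s) * dissipation (\<Theta> s)) \<le> 0" using \<mu>[of "y s"] by simp
    qed
    then show ?thesis by (simp add: \<mu>_def \<Theta>_def y y0)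
  qed
  then have "spherical_solution k1 k2 k3 k4 k5 {t0..} \<Theta>"
    using d\<Theta> S by (auto simp: spherical_solution_def)
  moreover have "\<Theta> t0 = \<Theta>0" by (simp add: \<Theta>_def y y0)
  ultimately show thesis by (rule that)
qed

end

subsection \<open>Cartesian coordinates\<close>

text \<open>\<open>P\<close> is the horizontal distance, positive by assumption, which keeps the
  elevation angle strictly inside its range.\<close>

lemma arcsin_elevation:
  fixes x y z \<rho> P :: real
  assumes "x\<^sup>2 + y\<^sup>2 > 0" and \<rho>_def: "\<rho> = sqrt (x\<^sup>2 + y\<^sup>2 + z\<^sup>2)" and P_def: "P = sqrt (x\<^sup>2 + y\<^sup>2)"
  shows "\<rho> > 0" "P > 0" "P\<^sup>2 = x\<^sup>2 + y\<^sup>2" "\<rho>\<^sup>2 = P\<^sup>2 + z\<^sup>2" "\<bar>z / \<rho>\<bar> < 1"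
    "sin (arcsin (z / \<rho>)) = z / \<rho>" "cos (arcsin (z / \<rho>)) = P / \<rho>" "\<bar>arcsin (z / \<rho>)\<bar> < pi / 2"
proof -
  have sum: "x\<^sup>2 + y\<^sup>2 + z\<^sup>2 > 0" using assms(1) by (simp add: add_pos_nonneg)
  show \<rho>: "\<rho> > 0" and P: "P > 0" using sum assms(1) by (simp_all add: \<rho>_def P_def)
  show P2: "P\<^sup>2 = x\<^sup>2 + y\<^sup>2" by (simp add: P_def)
  show \<rho>2: "\<rho>\<^sup>2 = P\<^sup>2 + z\<^sup>2" using sum by (simp add: \<rho>_def P2)
  have "\<bar>z\<bar> < \<rho>"
    using \<rho> \<rho>2 P by (intro power2_less_imp_less[of "\<bar>z\<bar>" \<rho>]) auto
  then show lt: "\<bar>z / \<rho>\<bar> < 1" using \<rho> by (simp add: abs_divide)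
  then have lt': "- 1 < z / \<rho>" "z / \<rho> < 1" by linarith+
  then show "sin (arcsin (z / \<rho>)) = z / \<rho>" by (intro sin_arcsin) auto
  have "(P / \<rho>)\<^sup>2 + (z / \<rho>)\<^sup>2 = (P\<^sup>2 + z\<^sup>2) / \<rho>\<^sup>2"
    by (simp add: power_divide add_divide_distrib)
  also have "\<dots> = 1" using \<rho> by (simp flip: \<rho>2)
  finally have "1 - (z / \<rho>)\<^sup>2 = (P / \<rho>)\<^sup>2" by simp
  then show "cos (arcsin (z / \<rho>)) = P / \<rho>"
    using lt' P \<rho> by (subst cos_arcsin) auto
  show "\<bar>arcsin (z / \<rho>)\<bar> < pi / 2"
    using arcsin_lt_bounded[of "z / \<rho>"] lt' by auto
qed

text \<open>Only continuity of \<open>d\<close> is given. But \<open>sin (d s - d t)\<close> is a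
  normalised cross product, hence differentiable in \<open>s\<close> at \<open>t\<close>, and near
  \<open>t\<close> continuity allows it to be inverted by \<open>arcsin\<close>, whose derivative at
  0 is 1.\<close>

lemma angle_lift_deriv:
  fixes p q d :: "real \<Rightarrow> real"
  assumes p: "(p has_real_derivative p') (at t within J)" and q: "(q has_real_derivative q') (at t within J)"
    and d: "continuous_on J d" and t: "t \<in> J"
    and pos: "\<And>s. s \<in> J \<Longrightarrow> (p s)\<^sup>2 + (q s)\<^sup>2 > 0"
    and polar: "\<And>s. s \<in> J \<Longrightarrow> p s = sqrt ((p s)\<^sup>2 + (q s)\<^sup>2) * cos (d s)"
      "\<And>s. s \<in> J \<Longrightarrow> q s = sqrt ((p s)\<^sup>2 + (q s)\<^sup>2) * sin (d s)"
  shows "(d has_real_derivative (p t * q' - q t * p') / ((p t)\<^sup>2 + (q t)\<^sup>2)) (at t within J)"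
proof -
  define R where "R s = sqrt ((p s)\<^sup>2 + (q s)\<^sup>2)" for s
  define g where "g s = (q s * p t - p s * q t) / (R s * R t)" for s
  have R: "R s > 0" if "s \<in> J" for s using pos[OF that] by (simp add: R_def)
  have R2: "R t * R t = (p t)\<^sup>2 + (q t)\<^sup>2" using pos[OF t] by (simp add: R_def)
  have g: "g s = sin (d s - d t)" if s: "s \<in> J" for s
  proof -
    have "q s * p t - p s * q t = (R s * sin (d s)) * (R t * cos (d t)) - (R s * cos (d s)) * (R t * sin (d t))"
      using polar[OF s] polar[OF t] by (simp add: R_def)
    also have "\<dots> = R s * R t * sin (d s - d t)" by (simp add: sin_diff algebra_simps)
    finally show ?thesis using R[OF s] R[OF t] by (simp add: g_def)
  qed
  have "((\<lambda>s. (p s)\<^sup>2 + (q s)\<^sup>2) has_real_derivative 2 * p t * p' + 2 * q t * q') (at t within J)"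
    by (auto intro!: derivative_eq_intros p q)
  from DERIV_chain2[OF DERIV_real_sqrt[OF pos[OF t]] this]
  obtain R' where R': "(R has_real_derivative R') (at t within J)"
    unfolding R_def by blast
  have n: "((\<lambda>s. q s * p t - p s * q t) has_real_derivative q' * p t - p' * q t) (at t within J)"
    by (auto intro!: derivative_eq_intros p q)
  have "(g has_real_derivative ((q' * p t - p' * q t) * (R t * R t) - (q t * p t - p t * q t) * (R' * R t))
     / ((R t * R t) * (R t * R t))) (at t within J)"
    unfolding g_def using R[OF t] by (intro DERIV_divide n DERIV_cmult_right R') auto
  moreover have "((q' * p t - p' * q t) * (R t * R t) - (q t * p t - p t * q t) * (R' * R t))
     / ((R t * R t) * (R t * R t)) = (p t * q' - q t * p') / ((p t)\<^sup>2 + (q t)\<^sup>2)"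
    using R[OF t] unfolding R2[symmetric] by (simp add: field_simps)
  ultimately have dg: "(g has_real_derivative (p t * q' - q t * p') / ((p t)\<^sup>2 + (q t)\<^sup>2)) (at t within J)"
    by simp
  have "g t = 0" by (simp add: g_def)
  then have "(arcsin has_real_derivative 1) (at (g t))"
    using DERIV_arcsin[of 0] by simp
  from DERIV_add[OF DERIV_const[where k = "d t"] DERIV_chain2[OF this dg]]
  have "((\<lambda>s. d t + arcsin (g s)) has_real_derivative (p t * q' - q t * p') / ((p t)\<^sup>2 + (q t)\<^sup>2)) (at t within J)"
    by simp
  \<comment> \<open>Here continuity selects the branch: close to \<open>t\<close> the difference of
    angles lies in the range of \<open>arcsin\<close>.\<close>
  moreover obtain e where e: "e > 0" "\<And>s. s \<in> J \<Longrightarrow> dist s t < e \<Longrightarrow> dist (d s) (d t) < pi / 2"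
    using d t unfolding continuous_on_iff by (metis pi_half_gt_zero)
  moreover have "d t + arcsin (g s) = d s" if "s \<in> J" "dist s t < e" for s
  proof -
    have "\<bar>d s - d t\<bar> < pi / 2" using e(2)[OF that] by (simp add: dist_real_def)
    then have "arcsin (sin (d s - d t)) = d s - d t" by (intro arcsin_sin) linarith+
    then show ?thesis using g[OF that(1)] by simp
  qed
  ultimately show ?thesis
    using has_field_derivative_transform_within[OF _ e(1) t] by blast
qed

text \<open>The lift \<open>d\<close> is an explicit parameter, because the feedback and the
  spherical trajectory have to use the same one. The rest is the chain rule.\<close>

lemma spherical_solution_of_cartesian:
  assumes "continuous_angle t0 J X d"
    and sol: "\<forall>t\<in>J. (case X t of (x, y, z, \<psi>, \<theta>) \<Rightarrow> x\<^sup>2 + y\<^sup>2 > 0) \<and>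
           (let \<Theta> = to_spherical (d t) (X t) in
             (X has_vector_derivative
                vehicle_field (feedback_v k1 k2 k3 \<Theta>) (feedback_q k1 k2 k3 k5 \<Theta>)
                  (feedback_r_tilde k1 k2 k3 k4 \<Theta>) (X t)) (at t within J))"
  shows "spherical_solution k1 k2 k3 k4 k5 J (\<lambda>t. to_spherical (d t) (X t))"
  unfolding spherical_solution_def
proof (intro ballI conjI)
  fix t assume t: "t \<in> J"
  define fx fy fz f\<psi> f\<theta> where
    "fx = (\<lambda>t. fst (X t))" and "fy = (\<lambda>t. fst (snd (X t)))" and "fz = (\<lambda>t. fst (snd (snd (X t))))"
    and "f\<psi> = (\<lambda>t. fst (snd (snd (snd (X t)))))" and "f\<theta> = (\<lambda>t. snd (snd (snd (snd (X t)))))"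
  note defs = fx_def fy_def fz_def f\<psi>_def f\<theta>_def
  have X: "X s = (fx s, fy s, fz s, f\<psi> s, f\<theta> s)" for s by (simp add: defs)
  define \<Theta> where "\<Theta> s = to_spherical (d s) (X s)" for s
  define x y z \<psi> \<theta> where "x = fx t" and "y = fy t" and "z = fz t" and "\<psi> = f\<psi> t" and "\<theta> = f\<theta> t"
  define \<rho> P \<zeta> where "\<rho> = sqrt (x\<^sup>2 + y\<^sup>2 + z\<^sup>2)" and "P = sqrt (x\<^sup>2 + y\<^sup>2)" and "\<zeta> = arcsin (z / \<rho>)"
  have \<Theta>: "\<Theta> s = (sqrt ((fx s)\<^sup>2 + (fy s)\<^sup>2 + (fz s)\<^sup>2), d s, d s - f\<psi> s,
      arcsin (fz s / sqrt ((fx s)\<^sup>2 + (fy s)\<^sup>2 + (fz s)\<^sup>2)), f\<theta> s)" for s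
    by (simp add: \<Theta>_def to_spherical_def X Let_def)
  have \<Theta>t: "\<Theta> t = (\<rho>, d t, d t - \<psi>, \<zeta>, \<theta>)"
    by (simp add: \<Theta> \<rho>_def \<zeta>_def x_def y_def z_def \<psi>_def \<theta>_def)
  have pos: "(fx s)\<^sup>2 + (fy s)\<^sup>2 > 0" if "s \<in> J" for s
    using sol that by (auto simp: X)
  note el = arcsin_elevation[OF pos[OF t, folded x_def y_def] \<rho>_def P_def, folded \<zeta>_def]
  show "to_spherical (d t) (X t) \<in> state_space"
    using \<Theta>t el by (simp add: \<Theta>_def state_space_def)
  define v q r where "v = feedback_v k1 k2 k3 (\<Theta> t)" and "q = feedback_q k1 k2 k3 k5 (\<Theta> t)"
    and "r = feedback_r_tilde k1 k2 k3 k4 (\<Theta> t)"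
  have "(X has_vector_derivative (v * cos \<psi> * cos \<theta>, v * sin \<psi> * cos \<theta>, v * sin \<theta>, r, q)) (at t within J)"
    using sol t by (auto simp: Let_def vehicle_field_def X v_def q_def r_def \<psi>_def \<theta>_def \<Theta>_def)
  note D = has_vector_derivative_tuple5D[OF this, folded defs, folded has_real_derivative_iff_has_vector_derivative]
  have polar: "- x = P * cos (d t)" "- y = P * sin (d t)"
    using assms(1) t by (auto simp: continuous_angle_def X x_def y_def P_def)
  \<comment> \<open>The component of the horizontal position along the heading; since
    \<open>d\<close> is the angle of the opposite vector, \<open>cos (d t - \<psi>)\<close> is minus
    its normalised value.\<close>
  define \<kappa> where "\<kappa> = x * cos \<psi> + y * sin \<psi>"
  have cg: "cos (d t - \<psi>) = - \<kappa> / P"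
  proof -
    have "P * cos (d t - \<psi>) = (P * cos (d t)) * cos \<psi> + (P * sin (d t)) * sin \<psi>"
      by (simp add: cos_diff algebra_simps)
    also have "\<dots> = - \<kappa>" unfolding polar[symmetric] by (simp add: \<kappa>_def)
    finally show ?thesis using el(2) by (simp add: field_simps)
  qed
  have sg: "sin (d t - \<psi>) = (x * sin \<psi> - y * cos \<psi>) / P"
  proof -
    have "P * sin (d t - \<psi>) = (P * sin (d t)) * cos \<psi> - (P * cos (d t)) * sin \<psi>"
      by (simp add: sin_diff algebra_simps)
    also have "\<dots> = x * sin \<psi> - y * cos \<psi>" unfolding polar[symmetric] by simp
    finally show ?thesis using el(2) by (simp add: field_simps)
  qed
  have polar_all: "- fx s = sqrt ((fx s)\<^sup>2 + (fy s)\<^sup>2) * cos (d s)" "- fy s = sqrt ((fx s)\<^sup>2 + (fy s)\<^sup>2) * sin (d s)"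
    if "s \<in> J" for s using assms(1) that by (auto simp: continuous_angle_def X)
  have contd: "continuous_on J d" using assms(1) by (simp add: continuous_angle_def)
  have "(d has_real_derivative ((- fx t) * - (v * sin \<psi> * cos \<theta>) - (- fy t) * - (v * cos \<psi> * cos \<theta>))
      / ((fx t)\<^sup>2 + (fy t)\<^sup>2)) (at t within J)"
    by (rule angle_lift_deriv[OF DERIV_minus[OF D(1)] DERIV_minus[OF D(2)] contd t,
        unfolded power2_minus, OF pos polar_all])
  also have "((- fx t) * - (v * sin \<psi> * cos \<theta>) - (- fy t) * - (v * cos \<psi> * cos \<theta>)) / ((fx t)\<^sup>2 + (fy t)\<^sup>2)
      = v * cos \<theta> / (\<rho> * cos \<zeta>) * sin (d t - \<psi>)"
  proof -
    have "\<rho> * cos \<zeta> = P" using el(1) el(7) by simp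
    moreover have "(fx t)\<^sup>2 + (fy t)\<^sup>2 = P * P"
      using el(3) by (simp add: x_def y_def power2_eq_square)
    ultimately show ?thesis
      unfolding sg using el(2) by (simp add: field_simps x_def y_def)
  qed
  finally have dd: "(d has_real_derivative v * cos \<theta> / (\<rho> * cos \<zeta>) * sin (d t - \<psi>)) (at t within J)" .
  have half: "inverse \<rho> / 2 * (2 * u) = u / \<rho>" for u
    by (simp add: field_simps)
  have dsq: "((\<lambda>s. (fx s)\<^sup>2 + (fy s)\<^sup>2 + (fz s)\<^sup>2) has_real_derivative
      2 * (v * (sin \<theta> * z + cos \<theta> * \<kappa>))) (at t within J)"
    by (auto intro!: derivative_eq_intros D simp: x_def y_def z_def \<kappa>_def algebra_simps)
  have dsqrt: "(sqrt has_real_derivative inverse \<rho> / 2) (at ((fx t)\<^sup>2 + (fy t)\<^sup>2 + (fz t)\<^sup>2))"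
    using DERIV_real_sqrt[of "x\<^sup>2 + y\<^sup>2 + z\<^sup>2"] el(1) by (simp add: \<rho>_def x_def y_def z_def)
  have "((\<lambda>s. sqrt ((fx s)\<^sup>2 + (fy s)\<^sup>2 + (fz s)\<^sup>2)) has_real_derivative
      inverse \<rho> / 2 * (2 * (v * (sin \<theta> * z + cos \<theta> * \<kappa>)))) (at t within J)"
    by (rule DERIV_chain2[OF dsqrt dsq])
  also have "inverse \<rho> / 2 * (2 * (v * (sin \<theta> * z + cos \<theta> * \<kappa>))) = v * (sin \<theta> * z + cos \<theta> * \<kappa>) / \<rho>"
    by (rule half)
  finally have d\<rho>: "((\<lambda>s. sqrt ((fx s)\<^sup>2 + (fy s)\<^sup>2 + (fz s)\<^sup>2)) has_real_derivative
      v * (sin \<theta> * z + cos \<theta> * \<kappa>) / \<rho>) (at t within J)" .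
  have dq: "((\<lambda>s. fz s / sqrt ((fx s)\<^sup>2 + (fy s)\<^sup>2 + (fz s)\<^sup>2)) has_real_derivative
      (v * sin \<theta> * \<rho> - z * (v * (sin \<theta> * z + cos \<theta> * \<kappa>) / \<rho>)) / (\<rho> * \<rho>)) (at t within J)"
    using DERIV_divide[OF D(3) d\<rho>] el(1) by (simp add: \<rho>_def x_def y_def z_def)
  have darc: "(arcsin has_real_derivative \<rho> / P) (at (fz t / sqrt ((fx t)\<^sup>2 + (fy t)\<^sup>2 + (fz t)\<^sup>2)))"
  proof -
    have b: "- 1 < z / \<rho>" "z / \<rho> < 1" using el(5) by linarith+
    then have "sqrt (1 - (z / \<rho>)\<^sup>2) = P / \<rho>"
      using el(7) cos_arcsin[of "z / \<rho>"] by (simp add: \<zeta>_def)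
    then show ?thesis
      using DERIV_arcsin[OF b] by (simp add: \<rho>_def x_def y_def z_def)
  qed
  have "((\<lambda>s. arcsin (fz s / sqrt ((fx s)\<^sup>2 + (fy s)\<^sup>2 + (fz s)\<^sup>2))) has_real_derivative
      \<rho> / P * ((v * sin \<theta> * \<rho> - z * (v * (sin \<theta> * z + cos \<theta> * \<kappa>) / \<rho>)) / (\<rho> * \<rho>))) (at t within J)"
    by (rule DERIV_chain2[OF darc dq])
  moreover have "\<rho> / P * ((v * sin \<theta> * \<rho> - z * (v * (sin \<theta> * z + cos \<theta> * \<kappa>) / \<rho>)) / (\<rho> * \<rho>))
      = v / \<rho> * (cos \<theta> * sin \<zeta> * cos (d t - \<psi>) + sin \<theta> * cos \<zeta>)"
  proof -
    have \<rho>z: "\<rho>\<^sup>2 - z\<^sup>2 = P\<^sup>2" using el(4) by simp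
    have "\<rho> / P * ((v * sin \<theta> * \<rho> - z * (v * (sin \<theta> * z + cos \<theta> * \<kappa>) / \<rho>)) / (\<rho> * \<rho>))
        = v * (sin \<theta> * (\<rho>\<^sup>2 - z\<^sup>2) - z * cos \<theta> * \<kappa>) / (P * \<rho>\<^sup>2)"
      using el(1,2) by (simp add: field_simps power2_eq_square)
    also have "\<dots> = v / \<rho> * (cos \<theta> * sin \<zeta> * cos (d t - \<psi>) + sin \<theta> * cos \<zeta>)"
      unfolding cg el(6,7) \<rho>z using el(1,2) by (simp add: field_simps power2_eq_square)
    finally show ?thesis .
  qed
  ultimately have d\<zeta>: "((\<lambda>s. arcsin (fz s / sqrt ((fx s)\<^sup>2 + (fy s)\<^sup>2 + (fz s)\<^sup>2))) has_real_derivative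
      v / \<rho> * (cos \<theta> * sin \<zeta> * cos (d t - \<psi>) + sin \<theta> * cos \<zeta>)) (at t within J)"
    by simp
  have \<rho>eq: "v * (sin \<theta> * z + cos \<theta> * \<kappa>) / \<rho> = v * (sin \<theta> * sin \<zeta> - cos \<theta> * cos \<zeta> * cos (d t - \<psi>))"
    unfolding cg el(6,7) using el(1,2) by (simp add: field_simps)
  have "spherical_field k1 k2 k3 k4 k5 (\<Theta> t) =
     (v * (sin \<theta> * sin \<zeta> - cos \<theta> * cos \<zeta> * cos (d t - \<psi>)),
      v * cos \<theta> / (\<rho> * cos \<zeta>) * sin (d t - \<psi>),
      v * cos \<theta> / (\<rho> * cos \<zeta>) * sin (d t - \<psi>) - r,
      v / \<rho> * (cos \<theta> * sin \<zeta> * cos (d t - \<psi>) + sin \<theta> * cos \<zeta>), q)"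
    unfolding v_def q_def r_def \<Theta>t by (simp add: spherical_field_def Let_def)
  moreover note V = d\<rho>[unfolded \<rho>eq] dd DERIV_diff[OF dd D(4)] d\<zeta> D(5)
  ultimately have "(\<Theta> has_vector_derivative spherical_field k1 k2 k3 k4 k5 (\<Theta> t)) (at t within J)"
    unfolding \<Theta>[abs_def]
    by (auto simp: has_real_derivative_iff_has_vector_derivative intro!: has_vector_derivative_Pair)
  then show "((\<lambda>t. to_spherical (d t) (X t)) has_vector_derivative
      spherical_field k1 k2 k3 k4 k5 (to_spherical (d t) (X t))) (at t within J)"
    by (simp add: \<Theta>_def[abs_def])
qed

text \<open>Inverse of \<open>to_spherical\<close>; the minus signs appear because
  \<open>\<delta>\<close> is the direction from the vehicle to the vertical axis.\<close>

definition of_spherical :: "state \<Rightarrow> state" where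
  "of_spherical = (\<lambda>(\<rho>, \<delta>, \<gamma>, \<zeta>, \<theta>).
     (- (\<rho> * cos \<zeta> * cos \<delta>), - (\<rho> * cos \<zeta> * sin \<delta>), \<rho> * sin \<zeta>, \<delta> - \<gamma>, \<theta>))"

lemma to_spherical_of_spherical:
  assumes "s \<in> state_space"
  shows "to_spherical (fst (snd s)) (of_spherical s) = s"
    and "of_spherical s = (x, y, z, \<psi>, \<theta>) \<Longrightarrow> sqrt (x\<^sup>2 + y\<^sup>2) = fst s * cos (fst (snd (snd (snd s))))"
    and "fst s * cos (fst (snd (snd (snd s)))) > 0"
proof -
  obtain r d g e h where s: "s = (r, d, g, e, h)" by (cases s) auto
  have r: "r > 0" and e: "\<bar>e\<bar> < pi / 2" using assms by (auto simp: s state_space_def)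
  have c: "cos e > 0" using e by (auto intro!: cos_gt_zero_pi)
  have xy: "(r * cos e * cos d)\<^sup>2 + (r * cos e * sin d)\<^sup>2 = (r * cos e)\<^sup>2"
    by (simp add: power_mult_distrib flip: distrib_left)
  have "(r * cos e * cos d)\<^sup>2 + (r * cos e * sin d)\<^sup>2 + (r * sin e)\<^sup>2 = r\<^sup>2"
    unfolding xy by (simp add: power_mult_distrib flip: distrib_left)
  then show "to_spherical (fst (snd s)) (of_spherical s) = s"
    using r e by (simp add: s to_spherical_def of_spherical_def Let_def arcsin_sin)
  show "fst s * cos (fst (snd (snd (snd s)))) > 0" using r c by (simp add: s)
  show "sqrt (x\<^sup>2 + y\<^sup>2) = fst s * cos (fst (snd (snd (snd s))))" if "of_spherical s = (x, y, z, \<psi>, \<theta>)"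
    using that xy r c by (auto simp: s of_spherical_def)
qed

lemma of_spherical_to_spherical:
  assumes "x\<^sup>2 + y\<^sup>2 > 0" and "- x = sqrt (x\<^sup>2 + y\<^sup>2) * cos d" "- y = sqrt (x\<^sup>2 + y\<^sup>2) * sin d"
  shows "of_spherical (to_spherical d (x, y, z, \<psi>, \<theta>)) = (x, y, z, \<psi>, \<theta>)"
proof -
  define \<rho> where "\<rho> = sqrt (x\<^sup>2 + y\<^sup>2 + z\<^sup>2)"
  note el = arcsin_elevation[OF assms(1) \<rho>_def refl]
  have "\<rho> * cos (arcsin (z / \<rho>)) = sqrt (x\<^sup>2 + y\<^sup>2)" "\<rho> * sin (arcsin (z / \<rho>)) = z"
    unfolding el(6,7) using el(1) by auto
  then show ?thesis
    using assms(2,3) by (simp add: of_spherical_def to_spherical_def Let_def flip: \<rho>_def)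
qed

text \<open>This carries existence over to Cartesian coordinates. The component
  \<open>\<delta>\<close> is itself the continuous lift required there, so the only extra demand is
  that it starts at the principal value.\<close>

lemma cartesian_solution_of_spherical:
  assumes sol: "spherical_solution k1 k2 k3 k4 k5 J \<Theta>" and t0: "t0 \<in> J"
    and init: "case of_spherical (\<Theta> t0) of (x, y, z, \<psi>, \<theta>) \<Rightarrow> fst (snd (\<Theta> t0)) = atan2 (- y) (- x)"
  shows "cartesian_solution k1 k2 k3 k4 k5 t0 J (\<lambda>t. of_spherical (\<Theta> t))"
proof -
  define f\<rho> f\<delta> f\<gamma> f\<zeta> f\<theta> where
    "f\<rho> = (\<lambda>t. fst (\<Theta> t))" and "f\<delta> = (\<lambda>t. fst (snd (\<Theta> t)))" and "f\<gamma> = (\<lambda>t. fst (snd (snd (\<Theta> t))))"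
    and "f\<zeta> = (\<lambda>t. fst (snd (snd (snd (\<Theta> t)))))" and "f\<theta> = (\<lambda>t. snd (snd (snd (snd (\<Theta> t)))))"
  note defs = f\<rho>_def f\<delta>_def f\<gamma>_def f\<zeta>_def f\<theta>_def
  have \<Theta>: "\<Theta> s = (f\<rho> s, f\<delta> s, f\<gamma> s, f\<zeta> s, f\<theta> s)" for s by (simp add: defs)
  have S: "\<Theta> s \<in> state_space" and d\<Theta>: "(\<Theta> has_vector_derivative spherical_field k1 k2 k3 k4 k5 (\<Theta> s)) (at s within J)"
    if "s \<in> J" for s using sol that by (auto simp: spherical_solution_def)
  have X: "of_spherical (\<Theta> s) = (- (f\<rho> s * cos (f\<zeta> s) * cos (f\<delta> s)), - (f\<rho> s * cos (f\<zeta> s) * sin (f\<delta> s)),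
      f\<rho> s * sin (f\<zeta> s), f\<delta> s - f\<gamma> s, f\<theta> s)" for s
    by (simp add: \<Theta> of_spherical_def)
  have P: "sqrt ((f\<rho> s * cos (f\<zeta> s) * cos (f\<delta> s))\<^sup>2 + (f\<rho> s * cos (f\<zeta> s) * sin (f\<delta> s))\<^sup>2) = f\<rho> s * cos (f\<zeta> s)"
    and Ppos: "f\<rho> s * cos (f\<zeta> s) > 0" if "s \<in> J" for s
    using to_spherical_of_spherical(2)[OF S[OF that] X] to_spherical_of_spherical(3)[OF S[OF that]]
    by (simp_all add: f\<rho>_def f\<zeta>_def)
  have inv: "to_spherical (f\<delta> s) (of_spherical (\<Theta> s)) = \<Theta> s" if "s \<in> J" for s
    using to_spherical_of_spherical(1)[OF S[OF that]] by (simp add: f\<delta>_def)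
  have "continuous_on J \<Theta>"
    using d\<Theta> has_vector_derivative_continuous continuous_on_eq_continuous_within by blast
  then have "continuous_on J f\<delta>"
    unfolding f\<delta>_def by (intro continuous_intros)
  then have c1: "continuous_angle t0 J (\<lambda>t. of_spherical (\<Theta> t)) f\<delta>"
    using init P by (auto simp: continuous_angle_def X f\<delta>_def[symmetric, THEN fun_cong])
  have c2: "case of_spherical (\<Theta> t) of (x, y, z, \<psi>, \<theta>) \<Rightarrow> x\<^sup>2 + y\<^sup>2 > 0" if "t \<in> J" for t
  proof -
    have "0 < sqrt ((f\<rho> t * cos (f\<zeta> t) * cos (f\<delta> t))\<^sup>2 + (f\<rho> t * cos (f\<zeta> t) * sin (f\<delta> t))\<^sup>2)"
      unfolding P[OF that] by (rule Ppos[OF that])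
    then show ?thesis by (simp only: real_sqrt_gt_0_iff X case_prod_conv power2_minus)
  qed
  have c3: "((\<lambda>t. of_spherical (\<Theta> t)) has_vector_derivative
      vehicle_field (feedback_v k1 k2 k3 (\<Theta> t)) (feedback_q k1 k2 k3 k5 (\<Theta> t))
        (feedback_r_tilde k1 k2 k3 k4 (\<Theta> t)) (of_spherical (\<Theta> t))) (at t within J)" if t: "t \<in> J" for t
  proof -
    define v q r where "v = feedback_v k1 k2 k3 (\<Theta> t)" and "q = feedback_q k1 k2 k3 k5 (\<Theta> t)"
      and "r = feedback_r_tilde k1 k2 k3 k4 (\<Theta> t)"
    define \<rho> \<delta> \<gamma> \<zeta> \<theta> where "\<rho> = f\<rho> t" and "\<delta> = f\<delta> t" and "\<gamma> = f\<gamma> t" and "\<zeta> = f\<zeta> t" and "\<theta> = f\<theta> t"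
    note vals = \<rho>_def \<delta>_def \<gamma>_def \<zeta>_def \<theta>_def
    have pos: "\<rho> > 0" "cos \<zeta> > 0"
      using S[OF t] by (auto simp: \<Theta> state_space_def vals intro!: cos_gt_zero_pi)
    define F1 F2 F4 where "F1 = v * (sin \<theta> * sin \<zeta> - cos \<theta> * cos \<zeta> * cos \<gamma>)"
      and "F2 = v * cos \<theta> / (\<rho> * cos \<zeta>) * sin \<gamma>"
      and "F4 = v / \<rho> * (cos \<theta> * sin \<zeta> * cos \<gamma> + sin \<theta> * cos \<zeta>)"
    have "spherical_field k1 k2 k3 k4 k5 (\<Theta> t) = (F1, F2, F2 - r, F4, q)"
      by (simp add: \<Theta> spherical_field_def Let_def F1_def F2_def F4_def v_def q_def r_def vals)
    note D = has_vector_derivative_tuple5D[OF d\<Theta>[OF t, unfolded this], folded defs,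
        folded has_real_derivative_iff_has_vector_derivative]
    \<comment> \<open>Rotation by \<open>\<zeta>\<close> turns the radial and elevation rates into
      the horizontal and vertical velocities.\<close>
    have rot: "v * (a * s - b * c * g) * c - r * s * (v / r * (b * s * g + a * c)) = - (v * b * g) * (s\<^sup>2 + c\<^sup>2)"
      "v * (a * s - b * c * g) * s + r * c * (v / r * (b * s * g + a * c)) = v * a * (s\<^sup>2 + c\<^sup>2)"
      if "r > 0" for a b c g r s :: real
      using that by (simp_all add: field_simps power2_eq_square)
    have PF: "F1 * cos \<zeta> - \<rho> * sin \<zeta> * F4 = - (v * cos \<theta> * cos \<gamma>)"
      unfolding F1_def F4_def rot(1)[OF pos(1)] by simp
    have PF2: "\<rho> * cos \<zeta> * F2 = v * cos \<theta> * sin \<gamma>"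
      using pos by (simp add: F2_def)
    have dP: "((\<lambda>s. f\<rho> s * cos (f\<zeta> s)) has_real_derivative - (v * cos \<theta> * cos \<gamma>)) (at t within J)"
      unfolding PF[symmetric] by (auto intro!: derivative_eq_intros D simp: vals)
    have dc: "((\<lambda>s. cos (f\<delta> s)) has_real_derivative - sin \<delta> * F2) (at t within J)"
      and ds: "((\<lambda>s. sin (f\<delta> s)) has_real_derivative cos \<delta> * F2) (at t within J)"
      by (auto intro!: derivative_eq_intros D simp: vals)
    have "((\<lambda>s. - (f\<rho> s * cos (f\<zeta> s) * cos (f\<delta> s))) has_real_derivative
        v * cos \<theta> * cos \<gamma> * cos \<delta> + \<rho> * cos \<zeta> * F2 * sin \<delta>) (at t within J)"
      by (rule DERIV_cong[OF DERIV_minus[OF DERIV_mult[OF dP dc]]]) (simp add: vals algebra_simps)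
    then have 1: "((\<lambda>s. - (f\<rho> s * cos (f\<zeta> s) * cos (f\<delta> s))) has_real_derivative
        v * cos (\<delta> - \<gamma>) * cos \<theta>) (at t within J)"
      unfolding PF2 by (simp add: cos_diff algebra_simps)
    have "((\<lambda>s. - (f\<rho> s * cos (f\<zeta> s) * sin (f\<delta> s))) has_real_derivative
        v * cos \<theta> * cos \<gamma> * sin \<delta> - \<rho> * cos \<zeta> * F2 * cos \<delta>) (at t within J)"
      by (rule DERIV_cong[OF DERIV_minus[OF DERIV_mult[OF dP ds]]]) (simp add: vals algebra_simps)
    then have 2: "((\<lambda>s. - (f\<rho> s * cos (f\<zeta> s) * sin (f\<delta> s))) has_real_derivative
        v * sin (\<delta> - \<gamma>) * cos \<theta>) (at t within J)"
      unfolding PF2 by (simp add: sin_diff algebra_simps)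
    have "F1 * sin \<zeta> + \<rho> * cos \<zeta> * F4 = v * sin \<theta>"
      unfolding F1_def F4_def rot(2)[OF pos(1)] by simp
    moreover have "((\<lambda>s. f\<rho> s * sin (f\<zeta> s)) has_real_derivative F1 * sin \<zeta> + \<rho> * cos \<zeta> * F4) (at t within J)"
      by (auto intro!: derivative_eq_intros D simp: vals)
    ultimately have 3: "((\<lambda>s. f\<rho> s * sin (f\<zeta> s)) has_real_derivative v * sin \<theta>) (at t within J)"
      by simp
    have 4: "((\<lambda>s. f\<delta> s - f\<gamma> s) has_real_derivative r) (at t within J)"
      using DERIV_diff[OF D(2,3)] by simp
    have "((\<lambda>s. of_spherical (\<Theta> s)) has_vector_derivative
        (v * cos (\<delta> - \<gamma>) * cos \<theta>, v * sin (\<delta> - \<gamma>) * cos \<theta>, v * sin \<theta>, r, q)) (at t within J)"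
      unfolding X using 1 2 3 4 D(5)
      by (auto simp: has_real_derivative_iff_has_vector_derivative intro!: has_vector_derivative_Pair)
    then show ?thesis
      by (simp add: vehicle_field_def X vals v_def q_def r_def)
  qed
  show ?thesis
    unfolding cartesian_solution_def Let_def
    by (intro exI[of _ f\<delta>] conjI ballI) (simp_all only: c1 c2 c3 inv)
qed

text \<open>Cauchy-Schwarz for three terms gives the factor \<open>sqrt 3\<close> on the position;
  \<open>\<bar>\<psi>\<bar> \<le> \<bar>d\<bar> + \<bar>d - \<psi>\<bar>\<close> handles the
  heading, and the angular part is relaxed by the same factor to allow one common constant.\<close>

lemma norm_D_to_spherical_ge:
  assumes "x\<^sup>2 + y\<^sup>2 > 0"
  shows "\<bar>x\<bar> + \<bar>y\<bar> + \<bar>z\<bar> + \<bar>\<psi>\<bar> + \<bar>\<theta>\<bar> \<le> sqrt 3 * norm_D (to_spherical d (x, y, z, \<psi>, \<theta>))"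
proof -
  define \<rho> where "\<rho> = sqrt (x\<^sup>2 + y\<^sup>2 + z\<^sup>2)"
  have "(\<bar>x\<bar> + \<bar>y\<bar> + \<bar>z\<bar>)\<^sup>2 + ((\<bar>x\<bar> - \<bar>y\<bar>)\<^sup>2 + (\<bar>y\<bar> - \<bar>z\<bar>)\<^sup>2 + (\<bar>x\<bar> - \<bar>z\<bar>)\<^sup>2) = 3 * (\<bar>x\<bar>\<^sup>2 + \<bar>y\<bar>\<^sup>2 + \<bar>z\<bar>\<^sup>2)"
    by (simp only: power2_eq_square) (simp only: algebra_simps)
  moreover have "(\<bar>x\<bar> - \<bar>y\<bar>)\<^sup>2 + (\<bar>y\<bar> - \<bar>z\<bar>)\<^sup>2 + (\<bar>x\<bar> - \<bar>z\<bar>)\<^sup>2 \<ge> 0" by simp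
  ultimately have "(\<bar>x\<bar> + \<bar>y\<bar> + \<bar>z\<bar>)\<^sup>2 \<le> 3 * (\<bar>x\<bar>\<^sup>2 + \<bar>y\<bar>\<^sup>2 + \<bar>z\<bar>\<^sup>2)" by linarith
  then have "\<bar>x\<bar> + \<bar>y\<bar> + \<bar>z\<bar> \<le> sqrt (3 * (x\<^sup>2 + y\<^sup>2 + z\<^sup>2))"
    by (intro real_le_rsqrt) simp
  then have xyz: "\<bar>x\<bar> + \<bar>y\<bar> + \<bar>z\<bar> \<le> sqrt 3 * \<rho>"
    by (simp only: \<rho>_def real_sqrt_mult)
  define T where "T = \<bar>d\<bar> + \<bar>d - \<psi>\<bar> + \<bar>tan (arcsin (z / \<rho>))\<bar> + \<bar>\<theta>\<bar>"
  have "a + e \<le> 1 * (b + c + u + e)" if "a \<le> b + c" "0 \<le> u" for a b c e u :: real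
    using that by simp
  from this[of "\<bar>\<psi>\<bar>" "\<bar>d\<bar>" "\<bar>d - \<psi>\<bar>"] have "\<bar>\<psi>\<bar> + \<bar>\<theta>\<bar> \<le> 1 * T"
    unfolding T_def by simp
  also have "\<dots> \<le> sqrt 3 * T"
    by (intro mult_right_mono) (auto simp: T_def)
  finally have "(\<bar>x\<bar> + \<bar>y\<bar> + \<bar>z\<bar>) + (\<bar>\<psi>\<bar> + \<bar>\<theta>\<bar>) \<le> sqrt 3 * \<rho> + sqrt 3 * T"
    by (rule add_mono[OF xyz])
  moreover have "norm_D (to_spherical d (x, y, z, \<psi>, \<theta>)) = \<rho> + T"
    by (simp add: norm_D_def to_spherical_def Let_def \<rho>_def T_def)
  ultimately show ?thesis by (simp only: distrib_left add.assoc)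
qed

text \<open>The 2 comes from \<open>\<bar>d\<bar>\<close>, which enters once as
  \<open>\<delta>\<close> and once through \<open>\<gamma> = d - \<psi>\<close>; the quotient by the
  horizontal distance is exactly \<open>\<bar>tan \<zeta>\<bar>\<close>.\<close>

lemma norm_D_to_spherical_le:
  assumes "x\<^sup>2 + y\<^sup>2 > 0"
  shows "norm_D (to_spherical d (x, y, z, \<psi>, \<theta>))
    \<le> 2 * (\<bar>x\<bar> + \<bar>y\<bar> + \<bar>z\<bar> + \<bar>\<psi>\<bar> + \<bar>\<theta>\<bar> + \<bar>d\<bar> + \<bar>z\<bar> / sqrt (x\<^sup>2 + y\<^sup>2))"
proof -
  define \<rho> P where "\<rho> = sqrt (x\<^sup>2 + y\<^sup>2 + z\<^sup>2)" and "P = sqrt (x\<^sup>2 + y\<^sup>2)"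
  note el = arcsin_elevation[OF assms \<rho>_def P_def]
  have "\<bar>tan (arcsin (z / \<rho>))\<bar> = \<bar>z\<bar> / P"
    unfolding tan_def el(6,7) using el(1,2) by simp
  moreover have "\<rho> \<le> \<bar>x\<bar> + \<bar>y\<bar> + \<bar>z\<bar>"
    unfolding \<rho>_def by (rule real_le_lsqrt) (auto simp: power2_eq_square algebra_simps)
  moreover have "norm_D (to_spherical d (x, y, z, \<psi>, \<theta>)) = \<rho> + \<bar>d\<bar> + \<bar>d - \<psi>\<bar> + \<bar>tan (arcsin (z / \<rho>))\<bar> + \<bar>\<theta>\<bar>"
    by (simp add: norm_D_def to_spherical_def Let_def \<rho>_def)
  moreover have "\<bar>d - \<psi>\<bar> \<le> \<bar>d\<bar> + \<bar>\<psi>\<bar>" "0 \<le> \<bar>z\<bar> / P" using el(2) by auto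
  ultimately have "norm_D (to_spherical d (x, y, z, \<psi>, \<theta>))
      \<le> \<bar>x\<bar> + \<bar>y\<bar> + \<bar>z\<bar> + \<bar>d\<bar> + (\<bar>d\<bar> + \<bar>\<psi>\<bar>) + \<bar>z\<bar> / P + \<bar>\<theta>\<bar>"
    by linarith
  also have "\<dots> \<le> 2 * (\<bar>x\<bar> + \<bar>y\<bar> + \<bar>z\<bar> + \<bar>\<psi>\<bar> + \<bar>\<theta>\<bar> + \<bar>d\<bar> + \<bar>z\<bar> / P)"
    using \<open>0 \<le> \<bar>z\<bar> / P\<close> by simp
  finally show ?thesis by (simp add: P_def)
qed

lemma atan2_polar:
  assumes "x\<^sup>2 + y\<^sup>2 > 0"
  shows "- x = sqrt (x\<^sup>2 + y\<^sup>2) * cos (atan2 (- y) (- x))"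
    "- y = sqrt (x\<^sup>2 + y\<^sup>2) * sin (atan2 (- y) (- x))"
proof -
  define w where "w = Complex (- x) (- y)"
  have n: "norm w = sqrt (x\<^sup>2 + y\<^sup>2)" by (simp add: w_def complex_norm)
  have "Re w = norm w * cos (Arg w)" "Im w = norm w * sin (Arg w)"
    by (metis rcis_cmod_Arg Re_rcis, metis rcis_cmod_Arg Im_rcis)
  then show "- x = sqrt (x\<^sup>2 + y\<^sup>2) * cos (atan2 (- y) (- x))"
    "- y = sqrt (x\<^sup>2 + y\<^sup>2) * sin (atan2 (- y) (- x))"
    unfolding n by (simp_all add: atan2_def w_def)
qed

lemma class_KL_exp:
  assumes "c > 0" "lam > 0"
  shows "class_KL t0 (\<lambda>s t. c * s * exp (- lam * (t - t0)))"
  unfolding class_KL_def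
proof (intro conjI allI impI)
  show "continuous_on ({0..} \<times> {t0..}) (\<lambda>(s, t). c * s * exp (- lam * (t - t0)))"
    by (auto simp: case_prod_unfold intro!: continuous_intros)
  show "c * 0 * exp (- lam * (t - t0)) = 0" for t by simp
  show "strict_mono_on {0..} (\<lambda>s. c * s * exp (- lam * (t - t0)))" for t
    using assms by (auto simp: strict_mono_on_def)
  fix s :: real assume s: "s \<ge> 0"
  show "antimono_on {t0..} (\<lambda>t. c * s * exp (- lam * (t - t0)))"
    using assms s by (auto simp: monotone_on_def intro!: mult_left_mono)
  have "((\<lambda>t. exp (- lam * (t - t0))) \<longlongrightarrow> 0) at_top"
  proof (rule filterlim_compose[OF exp_at_bot])
    show "LIM t at_top. - lam * (t - t0) :> at_bot"
      unfolding filterlim_at_bot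
    proof
      fix Z :: real
      show "\<forall>\<^sub>F t in at_top. - lam * (t - t0) \<le> Z"
        using eventually_ge_at_top[of "t0 - Z / lam"]
        by eventually_elim (use assms in \<open>simp add: field_simps\<close>)
    qed
  qed
  from tendsto_mult_left[OF this, of "c * s"]
  show "((\<lambda>t. c * s * exp (- lam * (t - t0))) \<longlongrightarrow> 0) at_top" by simp
qed

text \<open>Both estimates share \<open>K\<close> and \<open>lam\<close>. They are asserted for
  every solution on every forward interval, and existence on the half line is asserted next to them,
  so that neither holds vacuously.\<close>

theorem corollary1:
  fixes k1 k2 k3 k4 k5 :: real
  assumes "k1 > 0" and "k2 > 0" and "k3 > 0" and "k4 > 0" and "k5 > 0"
  shows "\<exists>K lam. K \<ge> 1 \<and> lam > 0 \<and>
    (\<forall>t0. \<forall>\<Theta>0\<in>state_space.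
       (\<exists>\<Theta>. spherical_solution k1 k2 k3 k4 k5 {t0..} \<Theta> \<and> \<Theta> t0 = \<Theta>0) \<and>
       (\<forall>J \<Theta>. forward_interval t0 J \<and> spherical_solution k1 k2 k3 k4 k5 J \<Theta> \<and> \<Theta> t0 = \<Theta>0 \<longrightarrow>
          (\<forall>t\<in>J. norm_D (\<Theta> t) \<le> K * norm_D \<Theta>0 * exp (- lam * (t - t0))))) \<and>
    (\<forall>t0. let \<beta> = (\<lambda>s t. 2 * sqrt 3 * K * s * exp (- lam * (t - t0))) in
       class_KL t0 \<beta> \<and>
       (\<forall>x0 y0 z0 \<psi>0 \<theta>0. x0\<^sup>2 + y0\<^sup>2 > 0 \<longrightarrow>
          (\<exists>X. cartesian_solution k1 k2 k3 k4 k5 t0 {t0..} X \<and> X t0 = (x0, y0, z0, \<psi>0, \<theta>0)) \<and>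
          (\<forall>J X. forward_interval t0 J \<and> cartesian_solution k1 k2 k3 k4 k5 t0 J X \<and>
                 X t0 = (x0, y0, z0, \<psi>0, \<theta>0) \<longrightarrow>
             (\<forall>t\<in>J. case X t of (x, y, z, \<psi>, \<theta>) \<Rightarrow>
                \<bar>x\<bar> + \<bar>y\<bar> + \<bar>z\<bar> + \<bar>\<psi>\<bar> + \<bar>\<theta>\<bar>
                \<le> \<beta> (\<bar>x0\<bar> + \<bar>y0\<bar> + \<bar>z0\<bar> + \<bar>\<psi>0\<bar> + \<bar>\<theta>0\<bar> + \<bar>atan2 (- y0) (- x0)\<bar>
                     + \<bar>z0\<bar> / sqrt (x0\<^sup>2 + y0\<^sup>2)) t))))"
proof -
  interpret gains k1 k2 k3 k4 k5 by unfold_locales (fact assms)+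
  define K where "K = 3 * gain\<^sup>2"
  have K: "K \<ge> 1"
  proof -
    have "1\<^sup>2 \<le> gain\<^sup>2" using assms by (intro power_mono) (auto simp: gain_def)
    then show ?thesis by (simp add: K_def)
  qed
  have cart_ex: "\<exists>X. cartesian_solution k1 k2 k3 k4 k5 t0 {t0..} X \<and> X t0 = (x0, y0, z0, \<psi>0, \<theta>0)"
    if xy: "x0\<^sup>2 + y0\<^sup>2 > 0" for t0 x0 y0 z0 \<psi>0 \<theta>0
  proof -
    define \<Theta>0 where "\<Theta>0 = to_spherical (atan2 (- y0) (- x0)) (x0, y0, z0, \<psi>0, \<theta>0)"
    have "\<Theta>0 \<in> state_space"
      using arcsin_elevation[where z = z0, OF xy refl refl] by (simp add: \<Theta>0_def to_spherical_def Let_def state_space_def)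
    then obtain \<Theta> where \<Theta>: "spherical_solution k1 k2 k3 k4 k5 {t0..} \<Theta>" "\<Theta> t0 = \<Theta>0"
      using spherical_solution_exists by blast
    have X0: "of_spherical \<Theta>0 = (x0, y0, z0, \<psi>0, \<theta>0)"
      unfolding \<Theta>0_def by (rule of_spherical_to_spherical[OF xy atan2_polar[OF xy]])
    have "cartesian_solution k1 k2 k3 k4 k5 t0 {t0..} (\<lambda>t. of_spherical (\<Theta> t))"
      \<comment> \<open>The initial condition on the angle holds because \<open>\<Theta>0\<close>
        was built with \<open>atan2\<close>.\<close>
      by (rule cartesian_solution_of_spherical[OF \<Theta>(1)])
         (simp_all add: \<Theta>(2) X0, simp add: \<Theta>0_def to_spherical_def Let_def)
    then show ?thesis using \<Theta>(2) X0 by auto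
  qed
  have cart_bound: "case X t of (x, y, z, \<psi>, \<theta>) \<Rightarrow>
      \<bar>x\<bar> + \<bar>y\<bar> + \<bar>z\<bar> + \<bar>\<psi>\<bar> + \<bar>\<theta>\<bar>
      \<le> 2 * sqrt 3 * K * (\<bar>x0\<bar> + \<bar>y0\<bar> + \<bar>z0\<bar> + \<bar>\<psi>0\<bar> + \<bar>\<theta>0\<bar> + \<bar>atan2 (- y0) (- x0)\<bar>
           + \<bar>z0\<bar> / sqrt (x0\<^sup>2 + y0\<^sup>2)) * exp (- rate * (t - t0))"
    if xy: "x0\<^sup>2 + y0\<^sup>2 > 0" and J: "forward_interval t0 J" and X: "cartesian_solution k1 k2 k3 k4 k5 t0 J X"
      and X0: "X t0 = (x0, y0, z0, \<psi>0, \<theta>0)" and t: "t \<in> J" for t0 x0 y0 z0 \<psi>0 \<theta>0 J X t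
  proof -
    obtain x y z \<psi> \<theta> where Xt: "X t = (x, y, z, \<psi>, \<theta>)" by (cases "X t") auto
    obtain d where d: "continuous_angle t0 J X d" and
      sol: "\<forall>t\<in>J. (case X t of (x, y, z, \<psi>, \<theta>) \<Rightarrow> x\<^sup>2 + y\<^sup>2 > 0) \<and>
           (let \<Theta> = to_spherical (d t) (X t) in
             (X has_vector_derivative
                vehicle_field (feedback_v k1 k2 k3 \<Theta>) (feedback_q k1 k2 k3 k5 \<Theta>)
                  (feedback_r_tilde k1 k2 k3 k4 \<Theta>) (X t)) (at t within J))"
      using X unfolding cartesian_solution_def by blast
    define S where "S = \<bar>x0\<bar> + \<bar>y0\<bar> + \<bar>z0\<bar> + \<bar>\<psi>0\<bar> + \<bar>\<theta>0\<bar> + \<bar>atan2 (- y0) (- x0)\<bar>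
           + \<bar>z0\<bar> / sqrt (x0\<^sup>2 + y0\<^sup>2)"
    \<comment> \<open>Decay concerns the unwrapped angle; only its initial value is the principal
      one that appears in the bound.\<close>
    have d0: "d t0 = atan2 (- y0) (- x0)" using d X0 by (auto simp: continuous_angle_def)
    have xyt: "x\<^sup>2 + y\<^sup>2 > 0" using sol t Xt by fastforce
    have "\<bar>x\<bar> + \<bar>y\<bar> + \<bar>z\<bar> + \<bar>\<psi>\<bar> + \<bar>\<theta>\<bar> \<le> sqrt 3 * norm_D (to_spherical (d t) (X t))"
      unfolding Xt by (rule norm_D_to_spherical_ge[OF xyt])
    also have "\<dots> \<le> sqrt 3 * (K * norm_D (to_spherical (d t0) (X t0)) * exp (- rate * (t - t0)))"
      unfolding K_def
      by (intro mult_left_mono norm_D_decay[OF J spherical_solution_of_cartesian[OF d sol] t]) auto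
    also have "\<dots> \<le> sqrt 3 * (K * (2 * S) * exp (- rate * (t - t0)))"
      unfolding X0 d0 S_def
      by (intro mult_left_mono mult_right_mono norm_D_to_spherical_le[OF xy]) (use K in auto)
    finally show ?thesis unfolding Xt S_def[symmetric] by (simp add: mult_ac)
  qed
  show ?thesis
  proof (rule exI[of _ K], rule exI[of _ rate], intro conjI allI ballI impI)
    show "K \<ge> 1" "rate > 0" by (fact K, fact rate(1))
  next
    fix t0 \<Theta>0 assume "\<Theta>0 \<in> state_space"
    then show "\<exists>\<Theta>. spherical_solution k1 k2 k3 k4 k5 {t0..} \<Theta> \<and> \<Theta> t0 = \<Theta>0"
      using spherical_solution_exists by metis
  next
    fix t0 \<Theta>0 J \<Theta> t
    assume "forward_interval t0 J \<and> spherical_solution k1 k2 k3 k4 k5 J \<Theta> \<and> \<Theta> t0 = \<Theta>0" "t \<in> J"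
    then show "norm_D (\<Theta> t) \<le> K * norm_D \<Theta>0 * exp (- rate * (t - t0))"
      using norm_D_decay[of t0 J \<Theta> t] by (auto simp: K_def)
  next
    fix t0
    have "class_KL t0 (\<lambda>s t. 2 * sqrt 3 * K * s * exp (- rate * (t - t0)))"
      using K rate(1) by (intro class_KL_exp) auto
    then show "let \<beta> = (\<lambda>s t. 2 * sqrt 3 * K * s * exp (- rate * (t - t0))) in
       class_KL t0 \<beta> \<and>
       (\<forall>x0 y0 z0 \<psi>0 \<theta>0. x0\<^sup>2 + y0\<^sup>2 > 0 \<longrightarrow>
          (\<exists>X. cartesian_solution k1 k2 k3 k4 k5 t0 {t0..} X \<and> X t0 = (x0, y0, z0, \<psi>0, \<theta>0)) \<and>
          (\<forall>J X. forward_interval t0 J \<and> cartesian_solution k1 k2 k3 k4 k5 t0 J X \<and>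
                 X t0 = (x0, y0, z0, \<psi>0, \<theta>0) \<longrightarrow>
             (\<forall>t\<in>J. case X t of (x, y, z, \<psi>, \<theta>) \<Rightarrow>
                \<bar>x\<bar> + \<bar>y\<bar> + \<bar>z\<bar> + \<bar>\<psi>\<bar> + \<bar>\<theta>\<bar>
                \<le> \<beta> (\<bar>x0\<bar> + \<bar>y0\<bar> + \<bar>z0\<bar> + \<bar>\<psi>0\<bar> + \<bar>\<theta>0\<bar> + \<bar>atan2 (- y0) (- x0)\<bar>
                     + \<bar>z0\<bar> / sqrt (x0\<^sup>2 + y0\<^sup>2)) t)))"
      unfolding Let_def
    proof (intro conjI allI impI ballI, goal_cases)
      case (2 x0 y0 z0 \<psi>0 \<theta>0)
      show ?case by (rule cart_ex[OF 2(2)])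
    next
      case (3 x0 y0 z0 \<psi>0 \<theta>0 J X t)
      show ?case
        by (rule cart_bound[OF 3(2) _ _ _ 3(4)]) (use 3(3) in simp_all)
    qed
  qed
qed

end
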